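(* Let $p$ be a nonnegative integer and let $x_1,\dots,x_n$ be complex parameters such that no denominator below vanishes. Then $$\begin{aligned} \frac{1}{(q)_{\infty}^{p}} &=\sum_{k_1,\dots,k_n\ge0}\ \prod_{1\leq r<s\leq n}\frac{1-q^{k_{r}-k_{s}}x_{r}/x_{s}}{1-x_{r}/x_{s}}\cdot\frac{(1-q^{2|\boldsymbol{k}|+1})(q)_{|\boldsymbol{k}|}}{\prod_{r,s=1}^{n}(qx_{r}/x_{s})_{k_{r}}}\\ &\quad\times(-1)^{n|\boldsymbol{k}|}q^{\sum_{r=1}^{n}(r-1)k_{r}+n\sum_{i=1}^{n}\binom{k_{i}}{2}}\prod_{r=1}^{n}x_{r}^{nk_{r}-|\boldsymbol{k}|}\\ &\quad\times\sum_{\substack{0\leq m_{r}\leq k_{r}\\ r=1,\dots,n}}\ \prod_{1\leq r<s\leq n}\frac{1-q^{m_{r}-m_{s}}x_{r}/x_{s}}{1-x_{r}/x_{s}}\prod_{r,s=1}^{n}\frac{(q^{-k_{s}}x_{r}/x_{s})_{m_{r}}}{(qx_{r}/x_{s})_{m_{r}}}\cdot\frac{(q^{|\boldsymbol{k}|+1})_{|\boldsymbol{m}|}}{\big((q)_{|\boldsymbol{m}|}\big)^{p+1}}q^{\sum_{r=1}^{n}rm_{r}} \end{aligned}$$ and $$\begin{aligned} \frac{1}{(q)_{\infty}^{p}} &=1+\sum_{\substack{k_{1},\dots,k_{n}\geq0\\ |\boldsymbol{k}|\geq1}}\ \prod_{1\leq r<s\leq n}\frac{1-q^{k_{r}-k_{s}}x_{r}/x_{s}}{1-x_{r}/x_{s}}\cdot\frac{(1-q^{2|\boldsymbol{k}|})(q)_{|\boldsymbol{k}|-1}}{\prod_{r,s=1}^{n}(qx_{r}/x_{s})_{k_{r}}}\\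 &\quad\times(-1)^{n|\boldsymbol{k}|}q^{\sum_{r=1}^{n}(r-1)k_{r}+n\sum_{i=1}^{n}\binom{k_{i}}{2}}\prod_{r=1}^{n}x_{r}^{nk_{r}-|\boldsymbol{k}|}\\ &\quad\times\sum_{\substack{0\leq m_{r}\leq k_{r}\\ r=1,\dots,n}}\ \prod_{1\leq r<s\leq n}\frac{1-q^{m_{r}-m_{s}}x_{r}/x_{s}}{1-x_{r}/x_{s}}\prod_{r,s=1}^{n}\frac{(q^{-k_{s}}x_{r}/x_{s})_{m_{r}}}{(qx_{r}/x_{s})_{m_{r}}}\cdot\frac{(q^{|\boldsymbol{k}|})_{|\boldsymbol{m}|}}{\big((q)_{|\boldsymbol{m}|}\big)^{p+1}}q^{\sum_{r=1}^{n}rm_{r}}. \end{aligned}$$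
   Context: $q$ is a complex number with $0<|q|<1$ and $n\ge1$ is an integer. $(z)_\infty=\prod_{i\ge0}(1-zq^i)$ and $(z)_k=(z)_\infty/(zq^k)_\infty=\prod_{i=0}^{k-1}(1-zq^i)$; $(q)_\infty^{p}$ is the $p$-th power of $(q)_\infty$. Bold letters denote multi-indices of nonnegative integers, $\boldsymbol k=(k_1,\dots,k_n)$, with $|\boldsymbol k|=k_1+\cdots+k_n$. *)

theory Defs
  imports "HOL-Analysis.Analysis"
begin

definition qpoch_inf :: "complex \<Rightarrow> complex \<Rightarrow> complex" where
  "qpoch_inf q z = (\<Prod>i. 1 - z * q ^ i)"

text \<open>The finite product is used rather than the quotient of infinite products: the two agree
  when the denominator is nonzero, but the quotient is 0/0 for \<open>z = q\<^sup>-\<^sup>k\<close>, which does occur.\<close>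

definition qpoch :: "complex \<Rightarrow> complex \<Rightarrow> nat \<Rightarrow> complex" where
  "qpoch q z k = (\<Prod>i<k. 1 - z * q ^ i)"

text \<open>Multi-indices \<open>(k\<^sub>1, \<dots>, k\<^sub>n)\<close> are functions on \<open>{1..n}\<close>, extended by \<open>undefined\<close> outside
  so that each tuple is represented exactly once.\<close>

definition multi_indices :: "nat \<Rightarrow> (nat \<Rightarrow> nat) set" where
  "multi_indices n = {1..n} \<rightarrow>\<^sub>E UNIV"

definition multi_indices_le :: "nat \<Rightarrow> (nat \<Rightarrow> nat) \<Rightarrow> (nat \<Rightarrow> nat) set" where
  "multi_indices_le n k = (\<Pi>\<^sub>E r\<in>{1..n}. {0..k r})"

definition weight :: "nat \<Rightarrow> (nat \<Rightarrow> nat) \<Rightarrow> nat" where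
  "weight n k = (\<Sum>r=1..n. k r)"

definition vandermonde_ratio ::
  "complex \<Rightarrow> nat \<Rightarrow> (nat \<Rightarrow> complex) \<Rightarrow> (nat \<Rightarrow> nat) \<Rightarrow> complex" where
  "vandermonde_ratio q n x k =
     (\<Prod>(r, s) \<in> {(r, s). 1 \<le> r \<and> r < s \<and> s \<le> n}.
        (1 - q powi (int (k r) - int (k s)) * (x r / x s)) / (1 - x r / x s))"

end

(* By Milne's A_n identity (milne_sum), a sum over |m| = M of the Vandermonde ratio times
   the products of the (a_s x_r/x_s)_{m_r} / (q x_r/x_s)_{m_r} depends on the a_s only through
   their product. For a_s = q^{-k_s} this collapses the inner sum to a single sum
   depending only on |k|; in the homogeneous limit a_s -> infinity it collapses the outer
   sum over |k| = K. What remains is the case n = 1, which telescopes: the K-th term is the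
   difference of consecutive values of partial_sum, and these tend to 1 / (q)_inf^p at the rate
   N |q|^N. Unconditional convergence holds because the weight of a single k is bounded
   by a multiple of |q|^(K(K-1)/2), of the same order as the whole sum over |k| = K. *)

theory Submission
  imports Defs
begin

section \<open>Interpolation and Milne's identity\<close>

text \<open>Milne's identity goes by induction on the level: Lagrange interpolation writes 1 - q^M
  as a sum over t whose t-th term vanishes when m_t = 0, and lowering m_t by one amounts to
  multiplying x_t and a_t by q. Hence x and a must vary in the induction, and genericity must
  survive the shift. With numerators written as products of b - a q^i, the limit a -> infinity is
  the substitution b = 0, so no limit is exchanged with a sum. The obstacle is absolute convergence.
  Already for n = 1 the part of level K with M = K tends to 1/(q)_inf^(p+1), so the decay comes only
  from cancellation inside the inner sum. The size of that sum is therefore read off from the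
  telescoping differences instead of being estimated term by term. The parameter \<open>e\<close> is
  1 for the first identity and 0 for the second.\<close>

lemma prod_linear_poly_degree_coeff:
  fixes b c :: "'i \<Rightarrow> 'a :: idom"
  assumes "finite I"
  shows "degree (\<Prod>s\<in>I. [:b s, c s:]) \<le> card I"
    and "coeff (\<Prod>s\<in>I. [:b s, c s:]) (card I) = (\<Prod>s\<in>I. c s)"
proof -
  \<comment> \<open>Only a bound on the degree, since some \<open>c s\<close> may be zero; the
    coefficient formula survives that case.\<close>
  have "degree (\<Prod>s\<in>I. [:b s, c s:]) \<le> card I \<and>
        coeff (\<Prod>s\<in>I. [:b s, c s:]) (card I) = (\<Prod>s\<in>I. c s)"
    using assms
  proof induction
    case (insert t I)
    let ?P = "\<Prod>s\<in>I. [:b s, c s:]"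
    have "degree ([:b t, c t:] * ?P) \<le> degree [:b t, c t:] + degree ?P"
      by (rule degree_mult_le)
    also have "\<dots> \<le> Suc (card I)"
      using insert by (simp add: add_mono)
    finally show ?case
      using insert by (simp add: coeff_eq_0)
  qed auto
  then show "degree (\<Prod>s\<in>I. [:b s, c s:]) \<le> card I"
    and "coeff (\<Prod>s\<in>I. [:b s, c s:]) (card I) = (\<Prod>s\<in>I. c s)"
    by auto
qed

text \<open>Lagrange interpolation of \<open>\<lambda>z. \<Prod>s\<in>I. b s - a s * (z / x s)\<close> at the nodes \<open>x r\<close>, evaluated
  at \<open>0\<close>; the term \<open>\<Prod>s\<in>I. a s\<close> corrects for the degree being one too high.\<close>

lemma partial_fraction_sum:
  fixes a b x :: "'i \<Rightarrow> 'a :: field"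
  assumes fin: "finite I" and nz: "\<And>r. r \<in> I \<Longrightarrow> x r \<noteq> 0" and inj: "inj_on x I"
  shows "(\<Sum>r\<in>I. (\<Prod>s\<in>I. b s - a s * (x r / x s)) / (\<Prod>s\<in>I - {r}. 1 - x r / x s))
         = (\<Prod>s\<in>I. b s) - (\<Prod>s\<in>I. a s)"
proof -
  define P where "P = (\<Prod>s\<in>I. [:b s, - (a s / x s):])"
  define R where "R = (\<Prod>s\<in>I. [:1, - (1 / x s):])"
  define l where "l r = (\<Prod>s\<in>I - {r}. [:1, - (1 / x s):])" for r
  define w where "w r = (\<Prod>s\<in>I. b s - a s * (x r / x s)) / (\<Prod>s\<in>I - {r}. 1 - x r / x s)" for r
  define Q where "Q = smult (\<Prod>s\<in>I. a s) R + (\<Sum>r\<in>I. smult (w r) (l r))"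
  have degl: "degree (l r) < card I" if "r \<in> I" for r
  proof -
    have "degree (l r) \<le> card (I - {r})"
      unfolding l_def using fin by (intro prod_linear_poly_degree_coeff) auto
    also have "\<dots> < card I"
      using fin that by (rule card_Diff1_less)
    finally show ?thesis .
  qed
  \<comment> \<open>\<open>R\<close> vanishes at every node, so it can adjust the top coefficient
    without disturbing the interpolated values; the card I nodes then determine the rest.\<close>
  have "P = Q"
  proof (rule poly_eqI_degree_lead_coeff)
    show "coeff P (card I) = coeff Q (card I)"
    proof -
      have "coeff (l r) (card I) = 0" if "r \<in> I" for r
        using degl[OF that] by (rule coeff_eq_0)
      moreover have "coeff P (card I) = (\<Prod>s\<in>I. a s) * coeff R (card I)"
        unfolding P_def R_def prod_linear_poly_degree_coeff[OF fin]
        by (simp flip: prod.distrib)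
      ultimately show ?thesis
        by (simp add: Q_def coeff_sum)
    qed
    show "card (x ` I) \<ge> card I"
      by (simp add: card_image inj)
    show "degree P \<le> card I"
      unfolding P_def by (rule prod_linear_poly_degree_coeff[OF fin])
    have "degree R \<le> card I"
      unfolding R_def by (rule prod_linear_poly_degree_coeff[OF fin])
    moreover have "degree (\<Sum>r\<in>I. smult (w r) (l r)) \<le> card I"
      using degl by (intro degree_sum_le fin) (meson degree_smult_le le_trans less_imp_le)
    ultimately show "degree Q \<le> card I"
      unfolding Q_def by (meson degree_add_le degree_smult_le le_trans)
    fix z assume "z \<in> x ` I"
    then obtain t where t: "t \<in> I" "z = x t"
      by auto
    have R0: "poly R z = 0"
      unfolding R_def poly_prod using t nz fin by (auto intro!: prod_zero bexI[of _ t])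
    have l0: "poly (l r) z = 0" if "r \<in> I - {t}" for r
      unfolding l_def poly_prod using t nz fin that by (auto intro!: prod_zero bexI[of _ t])
    have lt: "poly (l t) z = (\<Prod>s\<in>I - {t}. 1 - x t / x s)"
      unfolding l_def poly_prod t by simp
    have lt0: "poly (l t) z \<noteq> 0"
      unfolding lt using fin t nz inj by (auto simp: inj_on_def)
    have "poly Q z = (\<Sum>r\<in>I. w r * poly (l r) z)"
      by (simp add: Q_def R0 poly_sum)
    also have "\<dots> = w t * poly (l t) z"
      using fin t l0 by (simp add: sum.remove[of _ t])
    also have "\<dots> = (\<Prod>s\<in>I. b s - a s * (x t / x s))"
      using lt0 by (simp add: w_def lt)
    also have "\<dots> = poly P z"
      by (simp add: P_def poly_prod t mult.commute)
    finally show "poly P z = poly Q z" ..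
  qed
  then have "poly P 0 = poly Q 0"
    by simp
  then show ?thesis
    by (simp add: P_def Q_def R_def l_def poly_prod poly_sum w_def)
qed

section \<open>Generic parameters and q-shifted factorials\<close>

text \<open>For nonzero q: no ratio of two distinct parameters is an integer power of q. Natural
  exponents on both sides avoid division and make stability under x_t -> q x_t a mere change of
  exponent.\<close>

definition q_generic :: "complex \<Rightarrow> 'i set \<Rightarrow> ('i \<Rightarrow> complex) \<Rightarrow> bool" where
  "q_generic q I x \<longleftrightarrow> (\<forall>r\<in>I. x r \<noteq> 0) \<and>
     (\<forall>r\<in>I. \<forall>s\<in>I. r \<noteq> s \<longrightarrow> (\<forall>i j. x r * q ^ i \<noteq> x s * q ^ j))"

definition index_level :: "'i set \<Rightarrow> nat \<Rightarrow> ('i \<Rightarrow> nat) set" where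
  "index_level I M = {m \<in> I \<rightarrow>\<^sub>E UNIV. sum m I = M}"

definition less_pairs :: "'i::linorder set \<Rightarrow> ('i \<times> 'i) set" where
  "less_pairs I = {(r, s). r \<in> I \<and> s \<in> I \<and> r < s}"

text \<open>The Vandermonde product at the points x_r q^(m_r) over that at the x_r. Each factor is
  symmetric in r and s, unlike those of \<open>vandermonde_ratio\<close>, from which it differs by a
  power of q.\<close>

definition shifted_vandermonde ::
  "complex \<Rightarrow> 'i::linorder set \<Rightarrow> ('i \<Rightarrow> complex) \<Rightarrow> ('i \<Rightarrow> nat) \<Rightarrow> complex" where
  "shifted_vandermonde q I x m =
     (\<Prod>(r, s)\<in>less_pairs I. (x r * q ^ m r - x s * q ^ m s) / (x r - x s))"

definition qpoch_matrix ::
  "complex \<Rightarrow> 'i set \<Rightarrow> ('i \<Rightarrow> complex) \<Rightarrow> ('i \<Rightarrow> nat) \<Rightarrow> complex" where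
  "qpoch_matrix q I x m = (\<Prod>r\<in>I. \<Prod>s\<in>I. qpoch q (q * (x r / x s)) (m r))"

text \<open>The homogeneous form \<open>b\<^sup>k (a / b)\<^sub>k\<close>, in which \<open>b = 0\<close> is allowed.\<close>

definition hom_qpoch :: "complex \<Rightarrow> complex \<Rightarrow> complex \<Rightarrow> nat \<Rightarrow> complex" where
  "hom_qpoch q b a k = (\<Prod>i<k. b - a * q ^ i)"

lemma hom_qpoch_1: "hom_qpoch q 1 a k = qpoch q a k"
  by (simp add: hom_qpoch_def qpoch_def)

lemma hom_qpoch_Suc_left: "hom_qpoch q b a (Suc k) = (b - a) * hom_qpoch q b (q * a) k"
  by (simp add: hom_qpoch_def prod.lessThan_Suc_shift mult_ac del: prod.lessThan_Suc)

lemma qpoch_0 [simp]: "qpoch q z 0 = 1"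
  by (simp add: qpoch_def)

lemma qpoch_Suc: "qpoch q z (Suc k) = qpoch q z k * (1 - z * q ^ k)"
  by (simp add: qpoch_def)

lemma qpoch_Suc_left: "qpoch q z (Suc k) = (1 - z) * qpoch q (q * z) k"
  using hom_qpoch_Suc_left[of q 1 z k] by (simp add: hom_qpoch_1)

lemma q_genericD:
  assumes "q_generic q I x"
  shows "r \<in> I \<Longrightarrow> x r \<noteq> 0"
    and "r \<in> I \<Longrightarrow> s \<in> I \<Longrightarrow> r \<noteq> s \<Longrightarrow> x r * q ^ i \<noteq> x s * q ^ j"
  using assms unfolding q_generic_def by blast+

lemma q_generic_inj_on: "q_generic q I x \<Longrightarrow> inj_on x I"
  using q_genericD(2)[of q I x _ _ 0 0] by (fastforce simp: inj_on_def)

lemma q_generic_shift: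
  assumes "q_generic q I x" "q \<noteq> 0"
  shows "q_generic q I (x(t := q * x t))"
proof -
  have "(x(t := q * x t)) r * q ^ i = x r * q ^ (if r = t then Suc i else i)" for r i
    by simp
  then show ?thesis
    using assms unfolding q_generic_def by (simp only:) auto
qed

lemma qpoch_nonzero_iff: "qpoch q z k \<noteq> 0 \<longleftrightarrow> (\<forall>i<k. z * q ^ i \<noteq> 1)"
  by (auto simp: qpoch_def)

lemma power_neq_1:
  fixes q :: complex
  assumes "norm q < 1"
  shows "q ^ Suc i \<noteq> 1"
proof -
  have "norm (q ^ Suc i) < 1"
    using mult_left_le[of "norm q ^ i" "norm q"] power_le_one[of "norm q" i] assms
    by (simp add: norm_mult norm_power)
  then show ?thesis
    by auto
qed

lemma qpoch_q_nonzero: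
  assumes "norm q < 1"
  shows "qpoch q q k \<noteq> 0"
  using power_neq_1[OF assms] by (simp add: qpoch_nonzero_iff)

lemma q_generic_qpoch_nonzero:
  assumes "q_generic q I x" "norm q < 1" "r \<in> I" "s \<in> I"
  shows "qpoch q (q * (x r / x s)) k \<noteq> 0"
proof (cases "r = s")
  case True
  then show ?thesis
    using assms q_genericD(1)[OF assms(1)] qpoch_q_nonzero by simp
next
  case False
  have "q * (x r / x s) * q ^ i \<noteq> 1" for i
    using q_genericD(2)[OF assms(1,3,4) False, of "Suc i" 0] q_genericD(1)[OF assms(1,4)]
    by (auto simp: field_simps)
  then show ?thesis
    by (simp add: qpoch_nonzero_iff)
qed

section \<open>Effect of multiplying a single parameter by q\<close>

lemma prod_square_split:
  fixes g :: "'i \<Rightarrow> 'i \<Rightarrow> 'a :: comm_monoid_mult"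
  assumes "finite I" "t \<in> I"
  shows "(\<Prod>r\<in>I. \<Prod>s\<in>I. g r s) =
    g t t * (\<Prod>s\<in>I - {t}. g t s) * (\<Prod>r\<in>I - {t}. g r t) * (\<Prod>r\<in>I - {t}. \<Prod>s\<in>I - {t}. g r s)"
  using assms by (simp add: prod.remove[of I t] prod.distrib mult_ac)

text \<open>A change at the single node t affects only pairs containing t; symmetry of
  \<open>h\<close> lets such a pair be indexed by the partner of t, whichever of the two is
  larger.\<close>

lemma prod_less_pairs_containing:
  fixes h :: "'i::linorder \<Rightarrow> 'i \<Rightarrow> 'a :: comm_monoid_mult"
  assumes fin: "finite I" and t: "t \<in> I"
    and sym: "\<And>r s. h r s = h s r"
    and one: "\<And>r s. r \<noteq> t \<Longrightarrow> s \<noteq> t \<Longrightarrow> h r s = 1"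
  shows "(\<Prod>(r, s)\<in>less_pairs I. h r s) = (\<Prod>s\<in>I - {t}. h t s)"
proof -
  have fp: "finite (less_pairs I)"
    by (rule finite_subset[of _ "I \<times> I"]) (auto simp: less_pairs_def fin)
  have "(\<Prod>(r, s)\<in>less_pairs I. h r s) = (\<Prod>(r, s)\<in>{(r, s)\<in>less_pairs I. r = t \<or> s = t}. h r s)"
    using one by (intro prod.mono_neutral_right fp) auto
  also have "\<dots> = (\<Prod>s\<in>I - {t}. h t s)"
    using t sym
    by (intro prod.reindex_bij_witness[of _ "\<lambda>s. (min s t, max s t)"
          "\<lambda>(r, s). if r = t then s else r"])
       (auto simp: less_pairs_def min_def max_def split: if_splits)
  finally show ?thesis .
qed

text \<open>The numerators agree because (q x_t) q^(m_t) = x_t q^(m_t + 1). Only the denominators of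
  pairs containing t differ, and the extra product corrects them.\<close>

lemma shifted_vandermonde_shift:
  assumes fin: "finite I" and t: "t \<in> I" and gen: "q_generic q I x" and q0: "q \<noteq> 0"
  shows "shifted_vandermonde q I (x(t := q * x t)) m *
           (\<Prod>s\<in>I - {t}. (1 - q * (x t / x s)) / (1 - x t / x s)) =
         shifted_vandermonde q I x (m(t := Suc (m t)))"
proof -
  let ?x = "x(t := q * x t)"
  have inj: "inj_on ?x I" "inj_on x I"
    using q_generic_inj_on q_generic_shift[OF gen q0] gen by blast+
  \<comment> \<open>The value 1 away from t is imposed: for r = s the quotient would be 0/0 = 0, and
    \<open>prod_less_pairs_containing\<close> asks for 1 at all such arguments.\<close>
  define h where "h r s = (if r \<noteq> t \<and> s \<noteq> t then 1 else (?x r - ?x s) / (x r - x s))" for r s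
  have "h r s = h s r" for r s
  proof -
    have "(?x r - ?x s) / (x r - x s) = (?x s - ?x r) / (x s - x r)"
      using minus_divide_divide[of "?x r - ?x s" "x r - x s"] by (simp only: minus_diff_eq)
    then show ?thesis
      unfolding h_def by (simp only: conj_commute)
  qed
  then have "(\<Prod>(r, s)\<in>less_pairs I. h r s) = (\<Prod>s\<in>I - {t}. h t s)"
    by (intro prod_less_pairs_containing[OF fin t]) (auto simp: h_def)
  also have "\<dots> = (\<Prod>s\<in>I - {t}. (1 - q * (x t / x s)) / (1 - x t / x s))"
  proof (rule prod.cong[OF refl])
    fix s assume s: "s \<in> I - {t}"
    then have "x s \<noteq> 0" "x t \<noteq> x s"
      using q_genericD(1)[OF gen] inj(2) t by (auto simp: inj_on_def)
    then show "h t s = (1 - q * (x t / x s)) / (1 - x t / x s)"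
      using s by (auto simp: h_def field_simps)
  qed
  finally have "shifted_vandermonde q I ?x m *
           (\<Prod>s\<in>I - {t}. (1 - q * (x t / x s)) / (1 - x t / x s)) =
      (\<Prod>(r, s)\<in>less_pairs I. (?x r * q ^ m r - ?x s * q ^ m s) / (?x r - ?x s) * h r s)"
    unfolding shifted_vandermonde_def case_prod_unfold prod.distrib by simp
  also have "\<dots> = shifted_vandermonde q I x (m(t := Suc (m t)))"
    unfolding shifted_vandermonde_def
  proof (intro prod.cong refl, clarify)
    fix r s assume "(r, s) \<in> less_pairs I"
    then have "?x r - ?x s \<noteq> 0"
      using inj_onD[OF inj(1), of r s] by (auto simp: less_pairs_def simp del: fun_upd_apply)
    then show "(?x r * q ^ m r - ?x s * q ^ m s) / (?x r - ?x s) * h r s =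
       (x r * q ^ (m(t := Suc (m t))) r - x s * q ^ (m(t := Suc (m t))) s) / (x r - x s)"
      by (cases "r \<noteq> t \<and> s \<noteq> t") (auto simp: h_def mult_ac)
  qed
  finally show ?thesis .
qed

text \<open>The entry (t,t) gains a last factor. The rest of row t gains a first factor, its
  argument having moved up by q; column t moves down by q and trades its first factor for a new last
  one.\<close>

lemma qpoch_matrix_shift:
  assumes fin: "finite I" and t: "t \<in> I" and gen: "q_generic q I x" and q0: "q \<noteq> 0"
  shows "qpoch_matrix q I (x(t := q * x t)) m * (1 - q ^ Suc (m t)) *
           (\<Prod>s\<in>I - {t}. 1 - q * (x t / x s)) * (\<Prod>r\<in>I - {t}. 1 - q ^ m r * (x r / x t)) =
         qpoch_matrix q I x (m(t := Suc (m t))) * (\<Prod>r\<in>I - {t}. 1 - x r / x t)"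
proof -
  let ?x = "x(t := q * x t)" and ?m = "m(t := Suc (m t))"
  have xt: "x t \<noteq> 0"
    using q_genericD(1)[OF gen t] .
  have tt: "qpoch q (q * (?x t / ?x t)) (m t) * (1 - q ^ Suc (m t)) =
            qpoch q (q * (x t / x t)) (?m t)"
    using xt q0 by (simp add: qpoch_Suc)
  have ts: "qpoch q (q * (?x t / ?x s)) (m t) * (1 - q * (x t / x s)) =
            qpoch q (q * (x t / x s)) (?m t)" if "s \<in> I - {t}" for s
    using that by (simp add: qpoch_Suc_left)
  have rt: "qpoch q (q * (?x r / ?x t)) (m r) * (1 - q ^ m r * (x r / x t)) =
            qpoch q (q * (x r / x t)) (?m r) * (1 - x r / x t)" if "r \<in> I - {t}" for r
    using that q0 qpoch_Suc[of q "x r / x t" "m r"] qpoch_Suc_left[of q "x r / x t" "m r"]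
    by (simp add: mult_ac)
  have rearrange1: "a * b * c * d * e * f * g = (a * e) * (b * f) * (c * g) * d"
    and rearrange2: "a * b * (c * e) * d = a * b * c * d * e" for a b c d e f g :: complex
    by (simp_all only: mult_ac)
  let ?f = "\<lambda>x m r s. qpoch q (q * (x r / x s)) (m r)"
  have "qpoch_matrix q I ?x m * (1 - q ^ Suc (m t)) *
          (\<Prod>s\<in>I - {t}. 1 - q * (x t / x s)) * (\<Prod>r\<in>I - {t}. 1 - q ^ m r * (x r / x t)) =
        (?f ?x m t t * (1 - q ^ Suc (m t))) *
        (\<Prod>s\<in>I - {t}. ?f ?x m t s * (1 - q * (x t / x s))) *
        (\<Prod>r\<in>I - {t}. ?f ?x m r t * (1 - q ^ m r * (x r / x t))) *
        (\<Prod>r\<in>I - {t}. \<Prod>s\<in>I - {t}. ?f ?x m r s)"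
    unfolding qpoch_matrix_def prod_square_split[OF fin t] prod.distrib by (rule rearrange1)
  also have "(\<Prod>s\<in>I - {t}. ?f ?x m t s * (1 - q * (x t / x s))) = (\<Prod>s\<in>I - {t}. ?f x ?m t s)"
    using ts by (intro prod.cong refl) simp
  also have "(\<Prod>r\<in>I - {t}. ?f ?x m r t * (1 - q ^ m r * (x r / x t))) =
             (\<Prod>r\<in>I - {t}. ?f x ?m r t * (1 - x r / x t))"
    using rt by (intro prod.cong refl) simp
  also have "?f ?x m t t * (1 - q ^ Suc (m t)) = ?f x ?m t t"
    using tt by simp
  also have "(\<Prod>r\<in>I - {t}. \<Prod>s\<in>I - {t}. ?f ?x m r s) = (\<Prod>r\<in>I - {t}. \<Prod>s\<in>I - {t}. ?f x ?m r s)"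
    by (intro prod.cong refl) auto
  finally show ?thesis
    unfolding qpoch_matrix_def prod_square_split[OF fin t] prod.distrib
    using rearrange2 by (rule trans)
qed

definition milne_weight ::
  "complex \<Rightarrow> 'i::linorder set \<Rightarrow> ('i \<Rightarrow> complex) \<Rightarrow> ('i \<Rightarrow> nat) \<Rightarrow> complex" where
  "milne_weight q I x m = shifted_vandermonde q I x m / qpoch_matrix q I x m"

text \<open>The exchange behind the induction: raising m_t becomes x_t -> q x_t. The product
  \<open>B\<close> arises from both the Vandermonde and the matrix and cancels; what remains on each
  side is a denominator or quotient of the shape summed by
  \<open>partial_fraction_sum\<close>.\<close>

lemma milne_weight_shift:
  fixes m :: "'i::linorder \<Rightarrow> nat"
  assumes fin: "finite I" and t: "t \<in> I" and gen: "q_generic q I x"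
    and q0: "q \<noteq> 0" and q1: "norm q < 1"
  defines "m' \<equiv> m(t := Suc (m t))"
  shows "milne_weight q I (x(t := q * x t)) m / (\<Prod>s\<in>I - {t}. 1 - x t / x s) =
           milne_weight q I x m' *
           ((\<Prod>r\<in>I. 1 - q ^ m' r * (x r / x t)) / (\<Prod>r\<in>I - {t}. 1 - x r / x t))"
proof -
  let ?x = "x(t := q * x t)"
  have nz: "1 - x r / x s \<noteq> 0" if "r \<in> I" "s \<in> I" "r \<noteq> s" for r s
    using q_genericD(1)[OF gen that(2)] q_genericD(2)[OF gen that, of 0 0] by simp
  have nz': "1 - q * (x t / x s) \<noteq> 0" if "s \<in> I - {t}" for s
    using q_genericD(1)[OF gen, of s] q_genericD(2)[OF gen t, of s 1 0] that by (auto simp: field_simps)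
  define D where "D = (\<Prod>s\<in>I - {t}. 1 - x t / x s)"
  define E where "E = (\<Prod>r\<in>I - {t}. 1 - x r / x t)"
  define B where "B = (\<Prod>s\<in>I - {t}. 1 - q * (x t / x s))"
  define C where "C = (\<Prod>r\<in>I - {t}. 1 - q ^ m r * (x r / x t))"
  have D0: "D \<noteq> 0" and E0: "E \<noteq> 0" and B0: "B \<noteq> 0"
    unfolding D_def E_def B_def using nz nz' t fin by auto
  have M0: "qpoch_matrix q I y k \<noteq> 0" if "q_generic q I y" for y k
    unfolding qpoch_matrix_def using q_generic_qpoch_nonzero[OF that q1] fin by simp
  have V: "shifted_vandermonde q I ?x m * (B / D) = shifted_vandermonde q I x m'"
    using shifted_vandermonde_shift[OF fin t gen q0, of m]
    by (simp add: B_def D_def m'_def prod_dividef)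
  have Q: "qpoch_matrix q I ?x m * (1 - q ^ Suc (m t)) * B * C = qpoch_matrix q I x m' * E"
    using qpoch_matrix_shift[OF fin t gen q0, of m] by (simp only: B_def C_def E_def m'_def)
  have P: "(\<Prod>r\<in>I. 1 - q ^ m' r * (x r / x t)) = (1 - q ^ Suc (m t)) * C"
    unfolding prod.remove[OF fin t] C_def m'_def using q_genericD(1)[OF gen t] by simp
  have "milne_weight q I x m' * ((1 - q ^ Suc (m t)) * C / E) =
        shifted_vandermonde q I x m' * ((1 - q ^ Suc (m t)) * C) / (qpoch_matrix q I x m' * E)"
    by (simp add: milne_weight_def)
  also have "\<dots> = milne_weight q I ?x m / D"
  proof -
    \<comment> \<open>The right side of \<open>Q\<close> is nonzero, hence so is every factor on its
      left.\<close>
    have "C \<noteq> 0" "1 - q ^ Suc (m t) \<noteq> 0"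
      using M0[OF gen, of m'] E0 Q by auto
    then show ?thesis
      unfolding V[symmetric] Q[symmetric] milne_weight_def
      using M0[OF q_generic_shift[OF gen q0, of t], of m] D0 B0 by (simp add: field_simps)
  qed
  finally show ?thesis
    unfolding P D_def[symmetric] E_def[symmetric] by (rule sym)
qed

section \<open>Sums over a level and Milne's identity\<close>

lemma finite_index_level: "finite I \<Longrightarrow> finite (index_level I M)"
proof -
  assume fin: "finite I"
  then have "index_level I M \<subseteq> I \<rightarrow>\<^sub>E {..M}"
    by (auto simp: index_level_def PiE_def Pi_def intro: member_le_sum)
  then show "finite (index_level I M)"
    by (rule finite_subset) (simp add: finite_PiE fin)
qed

text \<open>Terms with m t = 0 drop out, and on the others lowering entry t is a bijection onto the
  level below.\<close>

lemma sum_index_level_Suc: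
  fixes g :: "('i \<Rightarrow> nat) \<Rightarrow> 'a :: comm_monoid_add"
  assumes fin: "finite I" and t: "t \<in> I" and g0: "\<And>m. m t = 0 \<Longrightarrow> g m = 0"
  shows "sum g (index_level I (Suc M)) = (\<Sum>m\<in>index_level I M. g (m(t := Suc (m t))))"
proof -
  have "sum g (index_level I (Suc M)) = sum g {m \<in> index_level I (Suc M). m t \<noteq> 0}"
    using g0 by (intro sum.mono_neutral_right finite_index_level fin) auto
  also have "\<dots> = (\<Sum>m\<in>index_level I M. g (m(t := Suc (m t))))"
    using t fin
    by (intro sum.reindex_bij_witness[of _ "\<lambda>m. m(t := Suc (m t))" "\<lambda>m. m(t := m t - 1)"])
       (auto simp: index_level_def PiE_iff extensional_def sum.remove[of I t])
  finally show ?thesis .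
qed

text \<open>Partial fractions enter twice. At the nodes 1/x_r they give 1 - q^(M+1) as the sum of
  the \<open>d m t\<close>; after swapping sums and lowering m_t, the hypothesis for the shifted x
  and a yields a value independent of t. At the nodes x_r they then sum the coefficients
  \<open>c t\<close>, which supply the first factor of the longer product.\<close>

theorem milne_sum:
  fixes x :: "'i::linorder \<Rightarrow> complex"
  assumes fin: "finite I" and gen: "q_generic q I x" and q0: "q \<noteq> 0" and q1: "norm q < 1"
  shows "(\<Sum>m\<in>index_level I M. milne_weight q I x m *
            (\<Prod>r\<in>I. \<Prod>s\<in>I. hom_qpoch q (b s) (a s * (x r / x s)) (m r))) =
         hom_qpoch q (\<Prod>s\<in>I. b s) (\<Prod>s\<in>I. a s) M / qpoch q q M"
  using gen
proof (induction M arbitrary: x a)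
  case 0
  have "index_level I 0 = {\<lambda>i\<in>I. 0}"
    using fin by (auto simp: index_level_def PiE_iff extensional_def fun_eq_iff)
  moreover have "x r - x s \<noteq> 0" if "r \<in> I" "s \<in> I" "r \<noteq> s" for r s
    using q_genericD(2)[OF 0 that, of 0 0] by simp
  ultimately show ?case
    by (simp add: milne_weight_def shifted_vandermonde_def qpoch_matrix_def hom_qpoch_def)
       (auto simp: less_pairs_def intro!: prod.neutral)
next
  case (Suc M)
  note gen = Suc.prems
  define N where "N x a m = (\<Prod>r\<in>I. \<Prod>s\<in>I. hom_qpoch q (b s) (a s * (x r / x s)) (m r))"
    for x a :: "'i \<Rightarrow> complex" and m
  define c where "c t = (\<Prod>s\<in>I. b s - a s * (x t / x s)) / (\<Prod>s\<in>I - {t}. 1 - x t / x s)" for t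
  define d where "d m t = (\<Prod>r\<in>I. 1 - q ^ m r * (x r / x t)) / (\<Prod>r\<in>I - {t}. 1 - x r / x t)"
    for m :: "'i \<Rightarrow> nat" and t
  note xnz = q_genericD(1)[OF gen]
  have Nstep: "N x a (m(t := Suc (m t))) =
      (\<Prod>s\<in>I. b s - a s * (x t / x s)) * N (x(t := q * x t)) (a(t := q * a t)) m"
    if t: "t \<in> I" for t m
  proof -
    \<comment> \<open>Shifting a_t along with x_t leaves column t unchanged off the diagonal, so
      exactly row t is multiplied by q.\<close>
    have ratio: "(a(t := q * a t)) s * ((x(t := q * x t)) r / (x(t := q * x t)) s) =
                 (if r = t then q else 1) * (a s * (x r / x s))" for r s
      using q0 xnz[OF t] by (auto simp: field_simps)
    show ?thesis
      unfolding N_def ratio prod.remove[OF fin t]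
      by (simp add: hom_qpoch_Suc_left prod.distrib mult_ac)
  qed
  have dsum: "(\<Sum>t\<in>I. d m t) = 1 - q ^ Suc M" if m: "m \<in> index_level I (Suc M)" for m
  proof -
    \<comment> \<open>Reciprocal nodes turn the quotients into x_r/x_t, the orientation occurring in
      \<open>d\<close>; the product of the q^(m_r) is q^(M+1) on this level.\<close>
    have "inj_on (\<lambda>r. 1 / x r) I"
      using q_generic_inj_on[OF gen] by (auto simp: inj_on_def)
    from partial_fraction_sum[OF fin _ this, of "\<lambda>_. 1" "\<lambda>r. q ^ m r"] xnz
    have "(\<Sum>t\<in>I. d m t) = 1 - (\<Prod>r\<in>I. q ^ m r)"
      by (simp add: d_def)
    then show ?thesis
      using m by (simp add: index_level_def flip: power_sum)
  qed
  have d0: "d m t = 0" if "t \<in> I" "m t = 0" for m t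
  proof -
    have "(\<Prod>r\<in>I. 1 - q ^ m r * (x r / x t)) = 0"
      using that fin xnz by (intro prod_zero) (auto intro!: bexI[of _ t])
    then show ?thesis
      by (simp add: d_def)
  qed
  have prod_upd: "(\<Prod>s\<in>I. (a(t := q * a t)) s) = q * (\<Prod>s\<in>I. a s)" if "t \<in> I" for t
    using fin that by (simp add: prod.remove[of I t])
  have "(1 - q ^ Suc M) * (\<Sum>m\<in>index_level I (Suc M). milne_weight q I x m * N x a m) =
        (\<Sum>m\<in>index_level I (Suc M). \<Sum>t\<in>I. milne_weight q I x m * d m t * N x a m)"
    unfolding sum_distrib_left
  proof (intro sum.cong refl)
    fix m assume "m \<in> index_level I (Suc M)"
    from dsum[OF this, symmetric]
    show "(1 - q ^ Suc M) * (milne_weight q I x m * N x a m) =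
          (\<Sum>t\<in>I. milne_weight q I x m * d m t * N x a m)"
      by (simp only: sum_distrib_left sum_distrib_right mult_ac)
  qed
  also have "\<dots> = (\<Sum>t\<in>I. \<Sum>m\<in>index_level I (Suc M). milne_weight q I x m * d m t * N x a m)"
    by (rule sum.swap)
  also have "\<dots> = (\<Sum>t\<in>I. c t * (\<Sum>m\<in>index_level I M.
      milne_weight q I (x(t := q * x t)) m * N (x(t := q * x t)) (a(t := q * a t)) m))"
    unfolding sum_distrib_left
  proof (rule sum.cong[OF refl])
    fix t assume t: "t \<in> I"
    show "(\<Sum>m\<in>index_level I (Suc M). milne_weight q I x m * d m t * N x a m) =
      (\<Sum>m\<in>index_level I M. c t *
        (milne_weight q I (x(t := q * x t)) m * N (x(t := q * x t)) (a(t := q * a t)) m))"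
      unfolding sum_index_level_Suc[OF fin t, of "\<lambda>m. milne_weight q I x m * d m t * N x a m" M,
          simplified d0[OF t], simplified]
    proof (rule sum.cong[OF refl])
      fix m
      show "milne_weight q I x (m(t := Suc (m t))) * d (m(t := Suc (m t))) t *
              N x a (m(t := Suc (m t))) =
            c t * (milne_weight q I (x(t := q * x t)) m *
              N (x(t := q * x t)) (a(t := q * a t)) m)"
        unfolding Nstep[OF t] d_def milne_weight_shift[OF fin t gen q0 q1, symmetric] c_def by simp
    qed
  qed
  also have "\<dots> = (\<Sum>t\<in>I. c t * (hom_qpoch q (\<Prod>s\<in>I. b s) (q * (\<Prod>s\<in>I. a s)) M / qpoch q q M))"
    using Suc.IH[OF q_generic_shift[OF gen q0]]
    by (intro sum.cong refl) (simp add: N_def prod_upd del: fun_upd_apply)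
  also have "\<dots> = ((\<Prod>s\<in>I. b s) - (\<Prod>s\<in>I. a s)) *
                    hom_qpoch q (\<Prod>s\<in>I. b s) (q * (\<Prod>s\<in>I. a s)) M / qpoch q q M"
  proof -
    have "(\<Sum>t\<in>I. c t) = (\<Prod>s\<in>I. b s) - (\<Prod>s\<in>I. a s)"
      unfolding c_def using xnz by (intro partial_fraction_sum fin q_generic_inj_on[OF gen])
    then show ?thesis
      by (simp only: sum_distrib_right[symmetric]) simp
  qed
  also have "\<dots> = hom_qpoch q (\<Prod>s\<in>I. b s) (\<Prod>s\<in>I. a s) (Suc M) / qpoch q q M"
    by (simp add: hom_qpoch_Suc_left)
  finally have "(1 - q ^ Suc M) *
      (\<Sum>m\<in>index_level I (Suc M). milne_weight q I x m * N x a m) =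
      hom_qpoch q (\<Prod>s\<in>I. b s) (\<Prod>s\<in>I. a s) (Suc M) / qpoch q q M" .
  moreover have "1 - q ^ Suc M \<noteq> 0"
    using power_neq_1[OF q1, of M] by simp
  ultimately have "(\<Sum>m\<in>index_level I (Suc M). milne_weight q I x m * N x a m) =
      hom_qpoch q (\<Prod>s\<in>I. b s) (\<Prod>s\<in>I. a s) (Suc M) / qpoch q q M / (1 - q ^ Suc M)"
    by (metis nonzero_mult_div_cancel_left)
  then show ?case
    unfolding N_def[symmetric] by (simp add: qpoch_Suc)
qed

section \<open>The one-dimensional telescoping sum\<close>

lemma qpoch_convergent_prod:
  fixes q z :: complex
  assumes "norm q < 1"
  shows "convergent_prod (\<lambda>i. 1 - z * q ^ i)"
proof -
  have "summable (\<lambda>i. norm z * norm q ^ i)"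
    using assms by (intro summable_mult summable_geometric) auto
  then have "summable (\<lambda>i. norm ((1 - z * q ^ i) - 1))"
    by (simp add: norm_mult norm_power del: summable_geometric_iff summable_cmult_iff)
  then show ?thesis
    by (intro abs_convergent_prod_imp_convergent_prod summable_imp_abs_convergent_prod)
qed

lemma qpoch_LIMSEQ:
  assumes "norm q < 1"
  shows "(\<lambda>k. qpoch q z k) \<longlonglongrightarrow> qpoch_inf q z"
proof (rule LIMSEQ_imp_Suc)
  show "(\<lambda>k. qpoch q z (Suc k)) \<longlonglongrightarrow> qpoch_inf q z"
    using convergent_prod_LIMSEQ[OF qpoch_convergent_prod[OF assms, of z]]
    by (simp add: qpoch_def qpoch_inf_def lessThan_Suc_atMost)
qed

lemma qpoch_inf_nonzero:
  assumes "norm q < 1" "\<And>k. qpoch q z k \<noteq> 0"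
  shows "qpoch_inf q z \<noteq> 0"
  unfolding qpoch_inf_def
proof (rule prodinf_nonzero[OF qpoch_convergent_prod[OF assms(1)]])
  show "1 - z * q ^ i \<noteq> 0" for i
    using assms(2)[of "Suc i"] by (simp add: qpoch_Suc)
qed

lemma qpoch_inverse_bounded:
  assumes "norm q < 1" "\<And>k. qpoch q z k \<noteq> 0"
  obtains B where "B > 0" "\<And>k. norm (1 / qpoch q z k) \<le> B"
proof -
  have "(\<lambda>k. 1 / qpoch q z k) \<longlonglongrightarrow> 1 / qpoch_inf q z"
    by (intro tendsto_divide tendsto_const qpoch_LIMSEQ qpoch_inf_nonzero assms)
  then have "Bseq (\<lambda>k. 1 / qpoch q z k)"
    by (intro convergent_imp_Bseq convergentI)
  then show ?thesis
    using that by (auto elim: BseqE)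
qed

lemma qpoch_bounded:
  assumes "norm q < 1"
  obtains B where "B > 0" "\<And>k. norm (qpoch q z k) \<le> B"
proof -
  have "Bseq (\<lambda>k. qpoch q z k)"
    using qpoch_LIMSEQ[OF assms] by (intro convergent_imp_Bseq convergentI)
  then show ?thesis
    using that by (auto elim: BseqE)
qed

section \<open>Rates of convergence, needed for summability as well as for the limit\<close>

definition geometric_rate :: "real \<Rightarrow> (nat \<Rightarrow> complex) \<Rightarrow> complex \<Rightarrow> bool" where
  "geometric_rate \<rho> a L \<longleftrightarrow> (\<exists>C\<ge>0. \<forall>n. norm (a n - L) \<le> C * \<rho> ^ n)"

lemma geometric_rateE:
  assumes "geometric_rate \<rho> a L"
  obtains C where "C \<ge> 0" "\<And>n. norm (a n - L) \<le> C * \<rho> ^ n"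
  using assms unfolding geometric_rate_def by blast

lemma geometric_rate_mult:
  assumes "geometric_rate \<rho> a L" "geometric_rate \<rho> b K" and \<rho>: "0 \<le> \<rho>" "\<rho> \<le> 1"
  shows "geometric_rate \<rho> (\<lambda>n. a n * b n) (L * K)"
proof -
  obtain C where C: "C \<ge> 0" "\<And>n. norm (a n - L) \<le> C * \<rho> ^ n"
    using geometric_rateE[OF assms(1)] by blast
  obtain D where D: "D \<ge> 0" "\<And>n. norm (b n - K) \<le> D * \<rho> ^ n"
    using geometric_rateE[OF assms(2)] by blast
  have "norm (a n * b n - L * K) \<le> (C * (D + norm K) + norm L * D) * \<rho> ^ n" for n
  proof -
    have p1: "\<rho> ^ n \<le> 1" "0 \<le> \<rho> ^ n"
      using \<rho> by (auto simp: power_le_one)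
    have "norm (b n) \<le> norm (b n - K) + norm K"
      using norm_triangle_ineq[of "b n - K" K] by simp
    also have "\<dots> \<le> D * \<rho> ^ n + norm K"
      using D by simp
    also have "\<dots> \<le> D + norm K"
      using mult_left_le[OF p1(1) D(1)] by simp
    finally have b: "norm (b n) \<le> D + norm K" .
    have "norm (a n * b n - L * K) = norm ((a n - L) * b n + L * (b n - K))"
      by (simp add: algebra_simps)
    also have "\<dots> \<le> norm (a n - L) * norm (b n) + norm L * norm (b n - K)"
      by (metis norm_mult norm_triangle_ineq)
    also have "\<dots> \<le> (C * \<rho> ^ n) * (D + norm K) + norm L * (D * \<rho> ^ n)"
      using C D b p1 by (intro add_mono mult_mono) auto
    finally show ?thesis
      by (simp add: algebra_simps)
  qed
  then show ?thesis
    unfolding geometric_rate_def using C(1) D(1)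
    by (intro exI[of _ "C * (D + norm K) + norm L * D"]) auto
qed

lemma geometric_rate_power:
  assumes "geometric_rate \<rho> a L" and \<rho>: "0 \<le> \<rho>" "\<rho> \<le> 1"
  shows "geometric_rate \<rho> (\<lambda>n. a n ^ k) (L ^ k)"
proof (induction k)
  case 0
  show ?case
    by (auto simp: geometric_rate_def intro!: exI[of _ 0])
next
  case (Suc k)
  from geometric_rate_mult[OF assms(1) this \<rho>] show ?case
    by simp
qed

lemma qpoch_geometric_rate:
  assumes q1: "norm q < 1"
  shows "geometric_rate (norm q) (qpoch q z) (qpoch_inf q z)"
proof -
  obtain B where B: "B > 0" "\<And>k. norm (qpoch q z k) \<le> B"
    using qpoch_bounded[OF q1, of z] by blast
  let ?C = "B * norm z / (1 - norm q)"
  \<comment> \<open>The constant sums the geometric series of consecutive differences. Keeping the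
    subtracted power makes the induction step exact; it is discarded afterwards.\<close>
  have diff: "norm (qpoch q z (n + k) - qpoch q z n) \<le> ?C * (norm q ^ n - norm q ^ (n + k))" for n k
  proof (induction k)
    case (Suc k)
    have "qpoch q z (n + Suc k) - qpoch q z n =
          (qpoch q z (n + k) - qpoch q z n) - qpoch q z (n + k) * z * q ^ (n + k)"
      by (simp add: qpoch_Suc algebra_simps)
    then have "norm (qpoch q z (n + Suc k) - qpoch q z n) \<le>
          norm (qpoch q z (n + k) - qpoch q z n) + norm (qpoch q z (n + k) * z * q ^ (n + k))"
      by (metis norm_triangle_ineq4)
    also have "\<dots> \<le> ?C * (norm q ^ n - norm q ^ (n + k)) + B * norm z * norm q ^ (n + k)"
      using Suc B(2) by (intro add_mono) (auto simp: norm_mult norm_power intro!: mult_right_mono)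
    also have "\<dots> = ?C * (norm q ^ n - norm q ^ (n + Suc k))"
      using q1 by (simp add: field_simps)
    finally show ?case .
  qed auto
  have "norm (qpoch q z n - qpoch_inf q z) \<le> ?C * norm q ^ n" for n
  proof (rule LIMSEQ_le_const2)
    show "(\<lambda>k. norm (qpoch q z n - qpoch q z k)) \<longlonglongrightarrow> norm (qpoch q z n - qpoch_inf q z)"
      by (intro tendsto_intros qpoch_LIMSEQ q1)
    have "norm (qpoch q z n - qpoch q z k) \<le> ?C * norm q ^ n" if "n \<le> k" for k
    proof -
      have "norm (qpoch q z n - qpoch q z k) \<le> ?C * (norm q ^ n - norm q ^ k)"
        using diff[of n "k - n"] that by (simp add: norm_minus_commute)
      also have "\<dots> \<le> ?C * norm q ^ n"
        using B(1) q1 by (intro mult_left_mono) auto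
      finally show ?thesis .
    qed
    then show "\<exists>N. \<forall>k\<ge>N. norm (qpoch q z n - qpoch q z k) \<le> ?C * norm q ^ n"
      by blast
  qed
  then show ?thesis
    unfolding geometric_rate_def using B(1) q1 by (intro exI[of _ ?C]) auto
qed

lemma qpoch_inverse_geometric_rate:
  assumes q1: "norm q < 1" and nz: "\<And>k. qpoch q z k \<noteq> 0"
  shows "geometric_rate (norm q) (\<lambda>k. 1 / qpoch q z k) (1 / qpoch_inf q z)"
proof -
  obtain B where B: "B > 0" "\<And>k. norm (1 / qpoch q z k) \<le> B"
    using qpoch_inverse_bounded[OF q1 nz] by blast
  obtain C where C: "C \<ge> 0" "\<And>n. norm (qpoch q z n - qpoch_inf q z) \<le> C * norm q ^ n"
    using geometric_rateE[OF qpoch_geometric_rate[OF q1]] by blast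
  let ?D = "B * C * norm (1 / qpoch_inf q z)"
  have "norm (1 / qpoch q z n - 1 / qpoch_inf q z) \<le> ?D * norm q ^ n" for n
  proof -
    have "1 / qpoch q z n - 1 / qpoch_inf q z =
        - (1 / qpoch q z n * (qpoch q z n - qpoch_inf q z) * (1 / qpoch_inf q z))"
      using nz[of n] qpoch_inf_nonzero[OF q1 nz] by (simp add: field_simps)
    then have "norm (1 / qpoch q z n - 1 / qpoch_inf q z) =
        norm (1 / qpoch q z n) * norm (qpoch q z n - qpoch_inf q z) * norm (1 / qpoch_inf q z)"
      by (simp only: norm_minus_cancel norm_mult)
    also have "\<dots> \<le> B * (C * norm q ^ n) * norm (1 / qpoch_inf q z)"
      using B C by (intro mult_mono) auto
    finally show ?thesis
      by (simp add: mult_ac)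
  qed
  then show ?thesis
    unfolding geometric_rate_def using B(1) C(1) by (intro exI[of _ ?D]) auto
qed

section \<open>Euler's expansion and the telescoping partial sums\<close>

text \<open>The coefficient of z^j in (qz)_inf. As 1/(z)_inf has coefficients 1/(q)_n, the
  convolution below reads off (qz)_inf / (z)_inf = 1/(1 - z).\<close>

definition euler_coeff :: "complex \<Rightarrow> nat \<Rightarrow> complex" where
  "euler_coeff q j = (-1) ^ j * q ^ (Suc j choose 2) / qpoch q q j"

lemma Suc_choose_2: "Suc j choose 2 = j + (j choose 2)"
  by (simp add: numeral_2_eq_2)

lemma euler_coeff_Suc:
  assumes "norm q < 1"
  shows "(1 - q ^ Suc j) * euler_coeff q (Suc j) = - (q ^ Suc j * euler_coeff q j)"
  using qpoch_q_nonzero[OF assms, of "Suc j"]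
  by (simp add: euler_coeff_def qpoch_Suc Suc_choose_2 power_add field_simps)

text \<open>Writing \<open>1 - q\<^sup>n = (1 - q\<^sup>n\<^sup>-\<^sup>j) + q\<^sup>n\<^sup>-\<^sup>j (1 - q\<^sup>j)\<close> shows that the sum does not depend on \<open>n\<close>.\<close>

lemma euler_coeff_convolution:
  assumes q1: "norm q < 1"
  shows "(\<Sum>j\<le>n. euler_coeff q j / qpoch q q (n - j)) = 1"
proof (induction n)
  case 0
  then show ?case by (simp add: euler_coeff_def numeral_2_eq_2)
next
  case (Suc n)
  note nz = qpoch_q_nonzero[OF q1]
  let ?c = "euler_coeff q" and ?h = "qpoch q q"
  have "(1 - q ^ Suc n) * (\<Sum>j\<le>Suc n. ?c j / ?h (Suc n - j)) =
        (\<Sum>j\<le>Suc n. (1 - q ^ (Suc n - j)) * ?c j / ?h (Suc n - j)) +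
        (\<Sum>j\<le>Suc n. q ^ (Suc n - j) * ((1 - q ^ j) * ?c j) / ?h (Suc n - j))"
    unfolding sum_distrib_left sum.distrib[symmetric]
  proof (rule sum.cong[OF refl])
    fix j assume "j \<in> {..Suc n}"
    then have "q ^ Suc n = q ^ (Suc n - j) * q ^ j"
      by (simp flip: power_add)
    then have *: "1 - q ^ Suc n = (1 - q ^ (Suc n - j)) + q ^ (Suc n - j) * (1 - q ^ j)"
      by (simp add: algebra_simps)
    show "(1 - q ^ Suc n) * (?c j / ?h (Suc n - j)) =
        (1 - q ^ (Suc n - j)) * ?c j / ?h (Suc n - j) +
        q ^ (Suc n - j) * ((1 - q ^ j) * ?c j) / ?h (Suc n - j)"
      unfolding * by (simp only: distrib_right times_divide_eq_right add_divide_distrib mult.assoc)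
  qed
  \<comment> \<open>The term j = Suc n carries 1 - q^0 = 0; in the others the factor cancels the
    last one of the denominator.\<close>
  also have "(\<Sum>j\<le>Suc n. (1 - q ^ (Suc n - j)) * ?c j / ?h (Suc n - j)) =
             (\<Sum>j\<le>n. ?c j / ?h (n - j))"
    unfolding sum.atMost_Suc
  proof -
    have "(1 - q ^ (Suc n - j)) * ?c j / ?h (Suc n - j) = ?c j / ?h (n - j)" if "j \<le> n" for j
      using nz[of "Suc (n - j)"] that by (simp add: Suc_diff_le qpoch_Suc)
    then show "(\<Sum>j\<le>n. (1 - q ^ (Suc n - j)) * ?c j / ?h (Suc n - j)) +
        (1 - q ^ (Suc n - Suc n)) * ?c (Suc n) / ?h (Suc n - Suc n) = (\<Sum>j\<le>n. ?c j / ?h (n - j))"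
      by simp
  qed
  \<comment> \<open>Here the term j = 0 vanishes, and \<open>euler_coeff_Suc\<close> moves the
    others down by one.\<close>
  also have "(\<Sum>j\<le>Suc n. q ^ (Suc n - j) * ((1 - q ^ j) * ?c j) / ?h (Suc n - j)) =
             - (q ^ Suc n) * (\<Sum>j\<le>n. ?c j / ?h (n - j))"
    unfolding sum.atMost_Suc_shift euler_coeff_Suc[OF q1] sum_distrib_left
  proof -
    have step: "q ^ (Suc n - Suc j) * (- (q ^ Suc j * ?c j)) / ?h (Suc n - Suc j) =
          - (q ^ Suc n) * (?c j / ?h (n - j))" if "j \<le> n" for j
    proof -
      have "Suc n = (n - j) + Suc j"
        using that by simp
      then have "q ^ Suc n = q ^ (n - j) * q ^ Suc j"
        by (simp only: power_add)
      moreover have "Suc n - Suc j = n - j"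
        by simp
      ultimately show ?thesis
        by (simp only: mult_minus_left mult_minus_right minus_divide_left[symmetric] times_divide_eq_right
            mult.assoc)
    qed
    have "(\<Sum>j\<le>n. q ^ (Suc n - Suc j) * (- (q ^ Suc j * ?c j)) / ?h (Suc n - Suc j)) =
        (\<Sum>j\<le>n. - (q ^ Suc n) * (?c j / ?h (n - j)))"
      by (rule sum.cong[OF refl], rule step) simp
    then show "q ^ (Suc n - 0) * ((1 - q ^ 0) * ?c 0) / ?h (Suc n - 0) +
        (\<Sum>j\<le>n. q ^ (Suc n - Suc j) * (- (q ^ Suc j * ?c j)) / ?h (Suc n - Suc j)) =
        (\<Sum>j\<le>n. - (q ^ Suc n) * (?c j / ?h (n - j)))"
      by (simp only:) simp
  qed
  finally have "(1 - q ^ Suc n) * (\<Sum>j\<le>Suc n. ?c j / ?h (Suc n - j)) = 1 - q ^ Suc n"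
    using Suc by simp
  then show ?case
    using power_neq_1[OF q1, of n] by simp
qed

text \<open>Closed form of the truncation at |k| <= N, including the leading 1 when e = 0. For fixed
  j the factor after \<open>euler_coeff\<close> tends to 1/(q)_inf^(p+1), and the Euler coefficients
  sum to (q)_inf, whence the limit 1/(q)_inf^p.\<close>

definition partial_sum :: "complex \<Rightarrow> nat \<Rightarrow> nat \<Rightarrow> nat \<Rightarrow> complex" where
  "partial_sum q e p N =
     (\<Sum>j\<le>N. euler_coeff q j * qpoch q q (2 * N - j + e) / qpoch q q (N - j) ^ (p + 2))"

text \<open>One factor 1/(q)_(N-j) is set aside, so that by \<open>euler_coeff_convolution\<close>
  the limit is a sum with the same weights. In the difference, term j is then O(|q|^j |q|^(N-j)),
  and there are N + 1 terms.\<close>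

lemma partial_sum_rate:
  assumes q1: "norm q < 1"
  obtains C where "C \<ge> 0"
    "\<And>N. norm (partial_sum q e p N - 1 / qpoch_inf q q ^ p) \<le> C * (real N + 1) * norm q ^ N"
proof -
  let ?h = "qpoch q q" and ?P = "qpoch_inf q q" and ?c = "euler_coeff q"
  note nz = qpoch_q_nonzero[OF q1]
  have P0: "?P \<noteq> 0"
    by (rule qpoch_inf_nonzero[OF q1 nz])
  obtain B where B: "B > 0" "\<And>k. norm (1 / ?h k) \<le> B"
    using qpoch_inverse_bounded[OF q1 nz] by blast
  obtain C1 where C1: "C1 \<ge> 0" "\<And>n. norm (?h n - ?P) \<le> C1 * norm q ^ n"
    using geometric_rateE[OF qpoch_geometric_rate[OF q1]] by blast
  obtain C2 where C2: "C2 \<ge> 0"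
      "\<And>n. norm ((1 / ?h n) ^ Suc p - (1 / ?P) ^ Suc p) \<le> C2 * norm q ^ n"
    using geometric_rateE[OF geometric_rate_power[OF qpoch_inverse_geometric_rate[OF q1 nz]
          norm_ge_zero less_imp_le[OF q1]], of "Suc p"] by blast
  define D where "D = C1 * B ^ Suc p + norm ?P * C2"
  have D0: "D \<ge> 0"
    using B C1 C2 by (simp add: D_def)
  have g: "norm (?h i' * (1 / ?h i) ^ Suc p - 1 / ?P ^ p) \<le> D * norm q ^ i" if "i \<le> i'" for i i'
  proof -
    have "norm (?h i' - ?P) \<le> C1 * norm q ^ i'"
      by (rule C1)
    also have "\<dots> \<le> C1 * norm q ^ i"
      using that q1 C1(1) by (intro mult_left_mono power_decreasing) auto
    finally have 1: "norm (?h i' - ?P) \<le> C1 * norm q ^ i" .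
    have 2: "norm ((1 / ?h i) ^ Suc p) \<le> B ^ Suc p"
      unfolding norm_power by (intro power_mono B) auto
    have "?h i' * (1 / ?h i) ^ Suc p - 1 / ?P ^ p =
          (?h i' - ?P) * (1 / ?h i) ^ Suc p + ?P * ((1 / ?h i) ^ Suc p - (1 / ?P) ^ Suc p)"
      using P0 by (simp add: left_diff_distrib right_diff_distrib power_one_over diff_divide_distrib)
    then have "norm (?h i' * (1 / ?h i) ^ Suc p - 1 / ?P ^ p) \<le>
          norm (?h i' - ?P) * norm ((1 / ?h i) ^ Suc p) +
          norm ?P * norm ((1 / ?h i) ^ Suc p - (1 / ?P) ^ Suc p)"
      by (metis norm_mult norm_triangle_ineq)
    also have "\<dots> \<le> (C1 * norm q ^ i) * B ^ Suc p + norm ?P * (C2 * norm q ^ i)"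
      using 1 2 C1 C2 by (intro add_mono mult_mono) auto
    finally show ?thesis
      by (simp add: D_def algebra_simps)
  qed
  have c: "norm (?c j) \<le> B * norm q ^ j" for j
  proof -
    have "norm (?c j) = norm (1 / ?h j) * norm q ^ (Suc j choose 2)"
      by (simp add: euler_coeff_def norm_mult norm_power norm_divide)
    also have "\<dots> \<le> B * norm q ^ j"
      using B q1 by (intro mult_mono power_decreasing) (auto simp: Suc_choose_2)
    finally show ?thesis .
  qed
  have "norm (partial_sum q e p N - 1 / ?P ^ p) \<le> (B * B * D) * (real N + 1) * norm q ^ N" for N
  proof -
    have "partial_sum q e p N - 1 / ?P ^ p =
      (\<Sum>j\<le>N. ?c j * ?h (2 * N - j + e) / ?h (N - j) ^ (p + 2)) -
      (\<Sum>j\<le>N. ?c j / ?h (N - j)) * (1 / ?P ^ p)"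
      by (simp add: euler_coeff_convolution[OF q1] partial_sum_def)
    also have "\<dots> = (\<Sum>j\<le>N. ?c j * (1 / ?h (N - j)) *
        (?h (2 * N - j + e) * (1 / ?h (N - j)) ^ Suc p - 1 / ?P ^ p))"
      unfolding sum_distrib_right sum_subtractf[symmetric]
      by (intro sum.cong refl) (simp add: algebra_simps power_one_over)
    also have "norm \<dots> \<le> (\<Sum>j\<le>N. (B * norm q ^ j) * B * (D * norm q ^ (N - j)))"
    proof (rule sum_norm_le)
      fix j assume "j \<in> {..N}"
      then have "N - j \<le> 2 * N - j + e"
        by simp
      from g[OF this] show "norm (?c j * (1 / ?h (N - j)) *
        (?h (2 * N - j + e) * (1 / ?h (N - j)) ^ Suc p - 1 / ?P ^ p)) \<le>
        (B * norm q ^ j) * B * (D * norm q ^ (N - j))"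
        unfolding norm_mult using c B by (intro mult_mono) auto
    qed
    also have "\<dots> = (\<Sum>j\<le>N. (B * B * D) * norm q ^ N)"
    proof (rule sum.cong[OF refl])
      fix j assume "j \<in> {..N}"
      then have "norm q ^ N = norm q ^ j * norm q ^ (N - j)"
        by (simp flip: power_add)
      then show "(B * norm q ^ j) * B * (D * norm q ^ (N - j)) = (B * B * D) * norm q ^ N"
        by simp
    qed
    also have "\<dots> = (B * B * D) * (real N + 1) * norm q ^ N"
      by (simp add: algebra_simps)
    finally show ?thesis .
  qed
  moreover have "B * B * D \<ge> 0"
    using B D0 by simp
  ultimately show ?thesis
    using that by blast
qed

text \<open>Term i + 1 of the longer sum is matched with term i of the shorter one, which has the
  same denominator power. With m = 2n - i + e the split 1 - q^(2n+2+e) = q^(i+1) (1 - q^(m+1)) + (1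
  - q^(i+1)) merges them; the unmatched term 0 contains the factor outright.\<close>

lemma partial_sum_diff:
  assumes q1: "norm q < 1"
  shows "partial_sum q e p (Suc n) - partial_sum q e p n =
    (1 - q ^ (2 * Suc n + e)) *
    (\<Sum>j\<le>Suc n. (-1) ^ j * q ^ (j choose 2) * qpoch q q (2 * n + 1 - j + e) /
       (qpoch q q j * qpoch q q (Suc n - j) ^ (p + 2)))"
proof -
  let ?h = "qpoch q q" and ?c = "euler_coeff q"
  note nz = qpoch_q_nonzero[OF q1]
  let ?t = "\<lambda>j. (1 - q ^ (2 * Suc n + e)) * ((-1) ^ j * q ^ (j choose 2) * ?h (2 * n + 1 - j + e) /
       (?h j * ?h (Suc n - j) ^ (p + 2)))"
  have step: "?c (Suc i) * ?h (2 * Suc n - Suc i + e) / ?h (Suc n - Suc i) ^ (p + 2) -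
        ?c i * ?h (2 * n - i + e) / ?h (n - i) ^ (p + 2) = ?t (Suc i)" if "i \<le> n" for i
  proof -
    define m where "m = 2 * n - i + e"
    have idx: "2 * Suc n - Suc i + e = Suc m" "2 * n + 1 - Suc i + e = m"
      using that by (auto simp: m_def)
    have "2 * Suc n + e = Suc i + Suc m"
      using that by (simp add: m_def)
    then have "q ^ (2 * Suc n + e) = q ^ Suc i * q ^ Suc m"
      by (simp only: power_add)
    then have key: "(1 - q ^ (2 * Suc n + e)) = q ^ Suc i * (1 - q ^ Suc m) + (1 - q ^ Suc i)"
      by (simp only: right_diff_distrib mult_1_right) simp
    have "?c (Suc i) * ?h (Suc m) - ?c i * ?h m =
          (-1) ^ Suc i * q ^ (Suc i choose 2) * ?h m / ?h (Suc i) * (1 - q ^ (2 * Suc n + e))"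
    proof -
      have hi: "?h i \<noteq> 0" "1 - q ^ Suc i \<noteq> 0"
        using nz[of i] power_neq_1[OF q1, of i] by simp_all
      have hs: "?h (Suc i) = ?h i * (1 - q ^ Suc i)" "?h (Suc m) = ?h m * (1 - q ^ Suc m)"
        by (simp_all add: qpoch_Suc)
      have cs: "?c (Suc i) = (-1) ^ Suc i * q ^ (Suc i choose 2) * q ^ Suc i / ?h (Suc i)"
        unfolding euler_coeff_def Suc_choose_2[of "Suc i"] power_add by simp
      have ci: "?c i = - ((-1) ^ Suc i * q ^ (Suc i choose 2) * (1 - q ^ Suc i) / ?h (Suc i))"
        unfolding hs using hi by (simp add: euler_coeff_def del: power_Suc) simp
      show ?thesis
        unfolding cs ci hs(2) key by (simp add: algebra_simps add_divide_distrib diff_divide_distrib)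
    qed
    then have "(?c (Suc i) * ?h (Suc m) - ?c i * ?h m) / ?h (n - i) ^ (p + 2) = ?t (Suc i)"
      unfolding idx by simp
    then show ?thesis
      unfolding idx m_def[symmetric] by (simp add: diff_divide_distrib)
  qed
  have first: "?c 0 * ?h (2 * Suc n - 0 + e) / ?h (Suc n - 0) ^ (p + 2) = ?t 0"
    by (simp add: euler_coeff_def qpoch_Suc numeral_2_eq_2)
  have "(\<Sum>i\<le>n. ?c (Suc i) * ?h (2 * Suc n - Suc i + e) / ?h (Suc n - Suc i) ^ (p + 2)) -
        (\<Sum>i\<le>n. ?c i * ?h (2 * n - i + e) / ?h (n - i) ^ (p + 2)) = (\<Sum>i\<le>n. ?t (Suc i))"
    unfolding sum_subtractf[symmetric] by (rule sum.cong[OF refl], rule step) simp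
  then have "partial_sum q e p (Suc n) - partial_sum q e p n = ?t 0 + (\<Sum>i\<le>n. ?t (Suc i))"
    unfolding partial_sum_def sum.atMost_Suc_shift first by (simp only: add_diff_eq[symmetric])
  then show ?thesis
    unfolding sum.atMost_Suc_shift sum_distrib_left distrib_left by simp
qed

text \<open>The classical evaluation of (q^-k)_m as a quotient of (q)_k by (q)_(k-m), multiplied out
  so that no negative power remains. The factor q^m is the one occurring in
  \<open>inner_sum\<close>.\<close>

lemma qpoch_neg_power:
  assumes q0: "q \<noteq> 0" and q1: "norm q < 1" and "m \<le> k"
  shows "q ^ (k choose 2) * q ^ m * qpoch q (q powi (- int k)) m * qpoch q q (k - m) =
         (-1) ^ m * q ^ (k - m choose 2) * qpoch q q k"
  using \<open>m \<le> k\<close>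
proof (induction m)
  case (Suc m)
  define d where "d = k - Suc m"
  have km: "k - m = Suc d" "k = Suc (d + m)"
    using Suc.prems by (auto simp: d_def)
  note nz = qpoch_q_nonzero[OF q1]
  have d1: "1 - q ^ Suc d \<noteq> 0"
    using power_neq_1[OF q1, of d] by simp
  have pw: "q powi (- int k) * q ^ m = 1 / q ^ Suc d"
    using q0 by (simp add: km power_int_minus power_add field_simps flip: of_nat_Suc)
  have "q ^ (k choose 2) * q ^ Suc m * qpoch q (q powi (- int k)) (Suc m) * qpoch q q d *
         (1 - q ^ Suc d) =
        (q ^ (k choose 2) * q ^ m * qpoch q (q powi (- int k)) m * qpoch q q (k - m)) *
        (q * (1 - 1 / q ^ Suc d))"
    unfolding qpoch_Suc pw km(1) by (simp add: qpoch_Suc mult_ac)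
  also have "\<dots> = (-1) ^ m * q ^ (Suc d choose 2) * qpoch q q k * (q * (1 - 1 / q ^ Suc d))"
    using Suc by (simp add: km(1))
  also have "\<dots> = (-1) ^ Suc m * q ^ (d choose 2) * qpoch q q k * (1 - q ^ Suc d)"
    using q0 by (simp add: Suc_choose_2 power_add field_simps)
  finally show ?case
    using d1 unfolding d_def by (metis (no_types, lifting) mult_right_cancel)
qed simp

text \<open>The inner sum of the identities in the case n = 1, k_1 = K.\<close>

definition inner_sum :: "complex \<Rightarrow> nat \<Rightarrow> nat \<Rightarrow> nat \<Rightarrow> complex" where
  "inner_sum q e p K =
     (\<Sum>M\<le>K. qpoch q (q powi (- int K)) M / qpoch q q M *
        (qpoch q (q ^ (K + e)) M / qpoch q q M ^ (p + 1)) * q ^ M)"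

lemma qpoch_add: "qpoch q z (m + n) = qpoch q z m * qpoch q (z * q ^ m) n"
  by (induction n) (simp_all add: qpoch_Suc power_add mult_ac)

text \<open>Put K = n + 1 and reverse by M = K - j. Then (q)_(n+e) and (q^(K+e))_M join to one
  factorial, and \<open>qpoch_neg_power\<close> supplies the remaining factors of
  \<open>partial_sum_diff\<close>.\<close>

lemma inner_sum_eq_diff:
  assumes q0: "q \<noteq> 0" and q1: "norm q < 1"
  shows "(1 - q ^ (2 * Suc n + e)) * qpoch q q (n + e) * inner_sum q e p (Suc n) *
           ((-1) ^ Suc n * q ^ (Suc n choose 2) / qpoch q q (Suc n)) =
         partial_sum q e p (Suc n) - partial_sum q e p n"
proof -
  let ?h = "qpoch q q" and ?K = "Suc n"
  note nz = qpoch_q_nonzero[OF q1]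
  have "?h (n + e) * ((-1) ^ ?K * q ^ (?K choose 2) / ?h ?K) * inner_sum q e p ?K =
     (\<Sum>M\<le>?K. (-1) ^ (?K - M) * q ^ (?K - M choose 2) * ?h (2 * n + 1 - (?K - M) + e) /
       (?h (?K - M) * ?h (?K - (?K - M)) ^ (p + 2)))"
    unfolding inner_sum_def sum_distrib_left
  proof (rule sum.cong[OF refl])
    fix M assume "M \<in> {..?K}"
    then have M: "M \<le> ?K"
      by simp
    have sign: "(-1) ^ ?K * (-1) ^ M = ((-1) ^ (?K - M) :: complex)"
      using M by (simp add: uminus_power_if)
    have up: "?h (n + e) * qpoch q (q ^ (?K + e)) M = ?h (2 * n + 1 - (?K - M) + e)"
    proof -
      have "2 * n + 1 - (?K - M) + e = (n + e) + M"
        using M by simp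
      moreover have "q ^ (?K + e) = q * q ^ (n + e)"
        by simp
      ultimately show ?thesis
        by (simp only: qpoch_add[of q q "n + e" M])
    qed
    have "q ^ (?K choose 2) * q ^ M * qpoch q (q powi (- int ?K)) M =
          (-1) ^ M * q ^ (?K - M choose 2) * ?h ?K / ?h (?K - M)"
      using qpoch_neg_power[OF q0 q1 M] nz[of "?K - M"] by (simp add: field_simps)
    then have "(-1) ^ ?K * (?h (n + e) * qpoch q (q ^ (?K + e)) M) *
           (q ^ (?K choose 2) * q ^ M * qpoch q (q powi (- int ?K)) M) / (?h ?K * ?h M ^ (p + 2)) =
       (-1) ^ ?K * ?h (2 * n + 1 - (?K - M) + e) *
           ((-1) ^ M * q ^ (?K - M choose 2) * ?h ?K / ?h (?K - M)) / (?h ?K * ?h M ^ (p + 2))"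
      unfolding up by simp
    also have "\<dots> = ((-1) ^ ?K * (-1) ^ M) * q ^ (?K - M choose 2) *
          ?h (2 * n + 1 - (?K - M) + e) / (?h (?K - M) * ?h M ^ (p + 2))"
      using nz[of ?K] by (simp del: power_Suc)
    finally show "?h (n + e) * ((-1) ^ ?K * q ^ (?K choose 2) / ?h ?K) *
        (qpoch q (q powi (- int ?K)) M / ?h M *
          (qpoch q (q ^ (?K + e)) M / ?h M ^ (p + 1)) * q ^ M) =
        (-1) ^ (?K - M) * q ^ (?K - M choose 2) * ?h (2 * n + 1 - (?K - M) + e) /
        (?h (?K - M) * ?h (?K - (?K - M)) ^ (p + 2))"
      unfolding sign using M by (simp add: mult_ac)
  qed
  also have "\<dots> = (\<Sum>j\<le>?K. (-1) ^ j * q ^ (j choose 2) * ?h (2 * n + 1 - j + e) /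
       (?h j * ?h (?K - j) ^ (p + 2)))"
    by (rule sum.reindex_bij_witness[of _ "\<lambda>j. ?K - j" "\<lambda>j. ?K - j"]) auto
  finally show ?thesis
    unfolding partial_sum_diff[OF q1] by (metis (no_types, lifting) mult.assoc mult.commute)
qed

section \<open>Bounds on the weights\<close>

text \<open>Stated for an abstract commutative monoid because it serves sums in
  \<open>choose_2_sum\<close> and products in \<open>outer_weight_bound\<close>.\<close>

lemma (in comm_monoid_set) square_less_pairs:
  fixes I :: "'i::linorder set"
  assumes fin: "finite I"
  shows "F (\<lambda>r. F (g r) I) I = F (\<lambda>r. g r r) I \<^bold>* F (\<lambda>(r, s). g r s \<^bold>* g s r) (less_pairs I)"
proof -
  let ?D = "{(r, s). r \<in> I \<and> s = r}" and ?U = "{(r, s). r \<in> I \<and> s \<in> I \<and> s < r}"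
  have sub: "less_pairs I \<subseteq> I \<times> I" "?D \<subseteq> I \<times> I" "?U \<subseteq> I \<times> I"
    by (auto simp: less_pairs_def)
  have fp: "finite (less_pairs I)" "finite ?D" "finite ?U"
    by (rule finite_subset[OF sub(1)] finite_subset[OF sub(2)] finite_subset[OF sub(3)];
        simp add: fin)+
  have "F (\<lambda>r. F (g r) I) I = F (\<lambda>(r, s). g r s) (I \<times> I)"
    by (rule cartesian_product)
  also have "I \<times> I = ?D \<union> (less_pairs I \<union> ?U)"
    by (auto simp: less_pairs_def)
  also have "F (\<lambda>(r, s). g r s) (?D \<union> (less_pairs I \<union> ?U)) =
      F (\<lambda>(r, s). g r s) ?D \<^bold>* (F (\<lambda>(r, s). g r s) (less_pairs I) \<^bold>* F (\<lambda>(r, s). g r s) ?U)"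
    using fp by (subst union_disjoint, simp, simp, force simp: less_pairs_def)
                (subst union_disjoint, auto simp: less_pairs_def)
  also have "F (\<lambda>(r, s). g r s) ?D = F (\<lambda>r. g r r) I"
    by (rule reindex_bij_witness[of _ "\<lambda>r. (r, r)" fst]) auto
  also have "F (\<lambda>(r, s). g r s) ?U = F (\<lambda>(r, s). g s r) (less_pairs I)"
    by (rule reindex_bij_witness[of _ prod.swap prod.swap]) (auto simp: less_pairs_def)
  also have "F (\<lambda>(r, s). g r s) (less_pairs I) \<^bold>* F (\<lambda>(r, s). g s r) (less_pairs I) =
             F (\<lambda>(r, s). g r s \<^bold>* g s r) (less_pairs I)"
    unfolding distrib[symmetric] by (intro cong refl) auto
  finally show ?thesis .
qed

lemma square_eq_choose_2: "k * k = 2 * (k choose 2) + k" for k :: nat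
  by (induction k) (auto simp: numeral_2_eq_2)

text \<open>Pairs among |k| objects in blocks of sizes k_r lie within a block or across two. The
  cross terms are what the Vandermonde pairs must contribute to the Gaussian decay.\<close>

lemma choose_2_sum:
  fixes k :: "'i::linorder \<Rightarrow> nat"
  assumes "finite I"
  shows "(sum k I choose 2) = (\<Sum>r\<in>I. k r choose 2) + (\<Sum>(r, s)\<in>less_pairs I. k r * k s)"
proof -
  have "2 * (sum k I choose 2) + sum k I = (\<Sum>r\<in>I. \<Sum>s\<in>I. k r * k s)"
    unfolding square_eq_choose_2[symmetric] by (simp add: sum_product)
  also have "\<dots> = (\<Sum>r\<in>I. k r * k r) + (\<Sum>(r, s)\<in>less_pairs I. k r * k s + k s * k r)"
    by (rule sum.square_less_pairs[OF assms])
  also have "\<dots> = 2 * ((\<Sum>r\<in>I. k r choose 2) + (\<Sum>(r, s)\<in>less_pairs I. k r * k s)) + sum k I"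
    unfolding square_eq_choose_2
    by (simp add: sum.distrib sum_distrib_left case_prod_unfold mult.commute)
       (simp flip: sum_distrib_left sum_distrib_right add: mult_2_right)
  finally show ?thesis
    by simp
qed

lemma power_choose_2_prod:
  fixes a :: "'a::comm_monoid_mult"
  shows "a ^ (d choose 2) = (\<Prod>i<d. a ^ i)"
  by (induction d) (auto simp: Suc_choose_2 power_add mult_ac numeral_2_eq_2)

text \<open>R may exceed 1. Bounding each factor t = R \<rho>^i by exp t turns the product into the
  exponential of a geometric sum.\<close>

lemma power_gaussian_bound:
  fixes R \<rho> :: real
  assumes "R \<ge> 0" "0 \<le> \<rho>" "\<rho> < 1"
  shows "R ^ d * \<rho> ^ (d choose 2) \<le> exp (R / (1 - \<rho>))"
proof -
  have "R ^ d * \<rho> ^ (d choose 2) = (\<Prod>i<d. R * \<rho> ^ i)"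
    by (simp add: power_choose_2_prod prod.distrib)
  also have "\<dots> \<le> (\<Prod>i<d. exp (R * \<rho> ^ i))"
  proof (rule prod_mono)
    fix i assume "i \<in> {..<d}"
    have "0 \<le> R * \<rho> ^ i"
      using assms by simp
    then show "0 \<le> R * \<rho> ^ i \<and> R * \<rho> ^ i \<le> exp (R * \<rho> ^ i)"
      using exp_ge_add_one_self[of "R * \<rho> ^ i"] by linarith
  qed
  also have "\<dots> = exp (R * (\<Sum>i<d. \<rho> ^ i))"
    by (simp add: exp_sum sum_distrib_left)
  also have "(\<Sum>i<d. \<rho> ^ i) = (1 - \<rho> ^ d) / (1 - \<rho>)"
    using assms by (simp add: sum_gp_strict)
  also have "exp (R * ((1 - \<rho> ^ d) / (1 - \<rho>))) \<le> exp (R / (1 - \<rho>))"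
    using assms by (auto intro!: divide_right_mono mult_left_le)
  finally show ?thesis .
qed

lemma choose_2_add: "(a + b choose 2) = (a choose 2) + (b choose 2) + a * b" for a b :: nat
  by (induction a) (auto simp: Suc_choose_2 numeral_2_eq_2[symmetric])

text \<open>The factor \<open>\<bar>q\<bar>\<^sup>a\<^sup>b\<close> is exact on the diagonal: for \<open>a = b + d\<close> the
  exponent of \<open>\<bar>q\<bar>\<close> on the left is \<open>a b + d (d - 1) / 2\<close>.\<close>

lemma pair_factor_bound_le:
  fixes q x y :: complex
  assumes q1: "norm q < 1" and xy: "x \<noteq> 0" "y \<noteq> 0" and ba: "b \<le> a"
  shows "norm ((x * q ^ a - y * q ^ b) / (x - y)) *
      (norm (x / y) ^ a * norm q ^ (a choose 2) * (norm (y / x) ^ b * norm q ^ (b choose 2)))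
    \<le> (norm x + norm y) / norm (x - y) * exp (norm (x / y) / (1 - norm q)) * norm q ^ (a * b)"
proof -
  define d where "d = a - b"
  have a: "a = b + d"
    using ba by (simp add: d_def)
  have "norm (x * q ^ a - y * q ^ b) = norm q ^ b * norm (x * q ^ d - y)"
    unfolding a norm_power[symmetric] norm_mult[symmetric] by (simp add: algebra_simps power_add)
  also have "\<dots> \<le> norm q ^ b * (norm x + norm y)"
  proof (rule mult_left_mono)
    have "norm (x * q ^ d - y) \<le> norm (x * q ^ d) + norm y"
      by (rule norm_triangle_ineq4)
    also have "norm (x * q ^ d) \<le> norm x"
      using q1 by (simp add: norm_mult norm_power mult_left_le power_le_one)
    finally show "norm (x * q ^ d - y) \<le> norm x + norm y"
      by simp
  qed auto
  finally have 1: "norm ((x * q ^ a - y * q ^ b) / (x - y)) \<le>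
      (norm x + norm y) / norm (x - y) * norm q ^ b"
    by (simp add: norm_divide divide_right_mono mult.commute)
  have e1: "norm (x / y) ^ a * norm (y / x) ^ b = norm (x / y) ^ d"
    using xy unfolding a by (simp add: power_add norm_divide power_divide)
  have "b + ((a choose 2) + (b choose 2)) = a * b + (d choose 2)"
    unfolding a choose_2_add using square_eq_choose_2[of b] by (simp add: algebra_simps)
  then have e2: "norm q ^ b * (norm q ^ (a choose 2) * norm q ^ (b choose 2)) =
      norm q ^ (a * b) * norm q ^ (d choose 2)"
    by (simp only: power_add[symmetric])
  have 2: "norm q ^ b *
      (norm (x / y) ^ a * norm q ^ (a choose 2) * (norm (y / x) ^ b * norm q ^ (b choose 2))) =
      norm q ^ (a * b) * (norm (x / y) ^ d * norm q ^ (d choose 2))"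
  proof -
    have "norm q ^ b *
        (norm (x / y) ^ a * norm q ^ (a choose 2) * (norm (y / x) ^ b * norm q ^ (b choose 2))) =
        (norm (x / y) ^ a * norm (y / x) ^ b) *
        (norm q ^ b * (norm q ^ (a choose 2) * norm q ^ (b choose 2)))"
      by (simp only: mult_ac)
    then show ?thesis
      unfolding e1 e2 by (simp only: mult_ac)
  qed
  have "norm ((x * q ^ a - y * q ^ b) / (x - y)) *
      (norm (x / y) ^ a * norm q ^ (a choose 2) * (norm (y / x) ^ b * norm q ^ (b choose 2)))
    \<le> ((norm x + norm y) / norm (x - y) * norm q ^ b) *
      (norm (x / y) ^ a * norm q ^ (a choose 2) * (norm (y / x) ^ b * norm q ^ (b choose 2)))"
    by (intro mult_right_mono 1) auto
  also have "\<dots> = (norm x + norm y) / norm (x - y) *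
      (norm q ^ (a * b) * (norm (x / y) ^ d * norm q ^ (d choose 2)))"
    unfolding mult.assoc[of "(norm x + norm y) / norm (x - y)"] 2 ..
  also have "\<dots> \<le> (norm x + norm y) / norm (x - y) *
      (norm q ^ (a * b) * exp (norm (x / y) / (1 - norm q)))"
    using q1 by (intro mult_left_mono power_gaussian_bound) auto
  finally show ?thesis
    by (simp only: mult_ac)
qed

lemma pair_factor_bound:
  fixes q x y :: complex
  assumes q1: "norm q < 1" and xy: "x \<noteq> 0" "y \<noteq> 0"
  obtains B where "B \<ge> 0"
    "\<And>a b. norm ((x * q ^ a - y * q ^ b) / (x - y)) *
      (norm (x / y) ^ a * norm q ^ (a choose 2) * (norm (y / x) ^ b * norm q ^ (b choose 2)))
    \<le> B * norm q ^ (a * b)"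
proof -
  define B where "B x y = (norm x + norm y) / norm (x - y) * exp (norm (x / y) / (1 - norm q))"
    for x y :: complex
  have nn: "B x y \<ge> 0" for x y
    by (simp add: B_def)
  have "norm ((x * q ^ a - y * q ^ b) / (x - y)) *
      (norm (x / y) ^ a * norm q ^ (a choose 2) * (norm (y / x) ^ b * norm q ^ (b choose 2)))
    \<le> (B x y + B y x) * norm q ^ (a * b)" for a b
  proof (cases "b \<le> a")
    case True
    have "B x y * norm q ^ (a * b) \<le> (B x y + B y x) * norm q ^ (a * b)"
      using nn by (intro mult_right_mono) auto
    with pair_factor_bound_le[OF q1 xy True] show ?thesis
      unfolding B_def by linarith
  next
    case False
    then have ab: "a \<le> b"
      by simp
    \<comment> \<open>Swapping (x, a) with (y, b) preserves the quantity to be bounded, so the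
      ordered case applies; adding the two constants covers both orders.\<close>
    have "norm ((x * q ^ a - y * q ^ b) / (x - y)) = norm ((y * q ^ b - x * q ^ a) / (y - x))"
      by (simp add: norm_divide norm_minus_commute)
    moreover have "B y x * norm q ^ (b * a) \<le> (B x y + B y x) * norm q ^ (a * b)"
      unfolding mult.commute[of b a] using nn by (intro mult_right_mono) auto
    ultimately show ?thesis
      using pair_factor_bound_le[OF q1 xy(2,1) ab] unfolding B_def
      by (simp only: mult.commute[of "norm (x / y) ^ a * norm q ^ (a choose 2)"])
  qed
  then show ?thesis
    using that[of "B x y + B y x"] nn by auto
qed

section \<open>The outer weight: its level sums and its size\<close>

lemma hom_qpoch_0: "hom_qpoch q 0 a k = (- a) ^ k * q ^ (k choose 2)"
proof -
  have "hom_qpoch q 0 a k = (\<Prod>i<k. - a * q ^ i)"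
    by (simp add: hom_qpoch_def)
  then show ?thesis
    by (simp only: prod.distrib power_choose_2_prod) simp
qed

text \<open>Milne's summand at b = 0, a = 1, where the numerators are monomials. They produce the
  sign, the Gaussian power of q and the powers of x in the theorem.\<close>

definition outer_weight ::
  "complex \<Rightarrow> 'i::linorder set \<Rightarrow> ('i \<Rightarrow> complex) \<Rightarrow> ('i \<Rightarrow> nat) \<Rightarrow> complex" where
  "outer_weight q I x k =
     milne_weight q I x k * (\<Prod>r\<in>I. \<Prod>s\<in>I. hom_qpoch q 0 (x r / x s) (k r))"

text \<open>As I is nonempty, the product of the zeros \<open>b s\<close> is 0, so the right side of
  Milne's identity is again a monomial over (q)_K.\<close>

lemma outer_weight_sum:
  assumes fin: "finite I" and I0: "I \<noteq> {}" and gen: "q_generic q I x"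
    and q0: "q \<noteq> 0" and q1: "norm q < 1"
  shows "(\<Sum>k\<in>index_level I K. outer_weight q I x k) =
         (-1) ^ K * q ^ (K choose 2) / qpoch q q K"
  using milne_sum[OF fin gen q0 q1, of "\<lambda>_. 0" "\<lambda>_. 1" K] I0 fin
  by (simp add: outer_weight_def hom_qpoch_0 power_0_left card_gt_0_iff)

text \<open>The denominators have bounded inverses and the diagonal numerators give the binomials of
  the single k_r. Joining the numerators (r,s) and (s,r) to the Vandermonde factor of that pair
  gives |q|^(k_r k_s); \<open>choose_2_sum\<close> adds up the exponents.\<close>

lemma outer_weight_bound:
  assumes fin: "finite I" and gen: "q_generic q I x" and q0: "q \<noteq> 0" and q1: "norm q < 1"
  obtains B where "B \<ge> 0"
    "\<And>k. norm (outer_weight q I x k) \<le> B * norm q ^ (sum k I choose 2)"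
proof -
  have "\<forall>r\<in>I. \<forall>s\<in>I. \<exists>B>0. \<forall>k. norm (1 / qpoch q (q * (x r / x s)) k) \<le> B"
    using qpoch_inverse_bounded[OF q1 q_generic_qpoch_nonzero[OF gen q1]] by metis
  then obtain A where A: "\<And>r s. r \<in> I \<Longrightarrow> s \<in> I \<Longrightarrow> A r s > 0"
      "\<And>r s k. r \<in> I \<Longrightarrow> s \<in> I \<Longrightarrow> norm (1 / qpoch q (q * (x r / x s)) k) \<le> A r s"
    by metis
  have Q: "norm (1 / qpoch_matrix q I x k) \<le> (\<Prod>r\<in>I. \<Prod>s\<in>I. A r s)" for k
  proof -
    have "norm (1 / qpoch_matrix q I x k) =
          (\<Prod>r\<in>I. \<Prod>s\<in>I. norm (1 / qpoch q (q * (x r / x s)) (k r)))"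
      by (simp add: qpoch_matrix_def prod_norm[symmetric] norm_divide prod_dividef)
    also have "\<dots> \<le> (\<Prod>r\<in>I. \<Prod>s\<in>I. A r s)"
      using A(2) by (intro prod_mono conjI prod_nonneg) auto
    finally show ?thesis .
  qed
  define f where "f r s a b = norm ((x r * q ^ a - x s * q ^ b) / (x r - x s)) *
      (norm (x r / x s) ^ a * norm q ^ (a choose 2) *
       (norm (x s / x r) ^ b * norm q ^ (b choose 2)))" for r s a b
  have "\<forall>r\<in>I. \<forall>s\<in>I. \<exists>B\<ge>0. \<forall>a b. f r s a b \<le> B * norm q ^ (a * b)"
    unfolding f_def using pair_factor_bound[OF q1] q_genericD(1)[OF gen] by metis
  then obtain B where B: "\<And>r s. r \<in> I \<Longrightarrow> s \<in> I \<Longrightarrow> B r s \<ge> 0"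
      "\<And>r s a b. r \<in> I \<Longrightarrow> s \<in> I \<Longrightarrow> f r s a b \<le> B r s * norm q ^ (a * b)"
    by metis
  define A' where "A' = (\<Prod>r\<in>I. \<Prod>s\<in>I. A r s)"
  define B' where "B' = (\<Prod>(r, s)\<in>less_pairs I. B r s)"
  have A'0: "A' \<ge> 0"
    unfolding A'_def using A(1) by (intro prod_nonneg) (auto simp: less_imp_le)
  have B'0: "B' \<ge> 0"
    unfolding B'_def using B(1) by (intro prod_nonneg) (auto simp: less_pairs_def)
  have "norm (outer_weight q I x k) \<le> (A' * B') * norm q ^ (sum k I choose 2)" for k
  proof -
    let ?g = "\<lambda>r s. norm (x r / x s) ^ k r * norm q ^ (k r choose 2)"
    have "norm (outer_weight q I x k) = norm (1 / qpoch_matrix q I x k) *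
        (norm (shifted_vandermonde q I x k) * (\<Prod>r\<in>I. \<Prod>s\<in>I. ?g r s))"
      by (simp add: outer_weight_def milne_weight_def norm_mult norm_divide prod_norm[symmetric]
          hom_qpoch_0 norm_power)
    also have "(\<Prod>r\<in>I. \<Prod>s\<in>I. ?g r s) =
        (\<Prod>r\<in>I. ?g r r) * (\<Prod>(r, s)\<in>less_pairs I. ?g r s * ?g s r)"
      by (rule prod.square_less_pairs[OF fin])
    also have "(\<Prod>r\<in>I. ?g r r) = norm q ^ (\<Sum>r\<in>I. k r choose 2)"
      unfolding power_sum using q_genericD(1)[OF gen] by (intro prod.cong refl) simp
    also have "norm (shifted_vandermonde q I x k) * (norm q ^ (\<Sum>r\<in>I. k r choose 2) *
          (\<Prod>(r, s)\<in>less_pairs I. ?g r s * ?g s r)) =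
        norm q ^ (\<Sum>r\<in>I. k r choose 2) * (\<Prod>(r, s)\<in>less_pairs I. f r s (k r) (k s))"
      unfolding f_def shifted_vandermonde_def case_prod_unfold prod.distrib prod_norm[symmetric]
      by (simp only: mult_ac)
    also have "norm (1 / qpoch_matrix q I x k) * \<dots> \<le> A' * (norm q ^ (\<Sum>r\<in>I. k r choose 2) *
        (\<Prod>(r, s)\<in>less_pairs I. B r s * norm q ^ (k r * k s)))"
    proof (intro mult_mono mult_left_mono prod_mono, unfold case_prod_unfold)
      show "norm (1 / qpoch_matrix q I x k) \<le> A'"
        unfolding A'_def by (rule Q)
      fix z assume "z \<in> less_pairs I"
      then show "0 \<le> f (fst z) (snd z) (k (fst z)) (k (snd z)) \<and>
          f (fst z) (snd z) (k (fst z)) (k (snd z)) \<le>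
          B (fst z) (snd z) * norm q ^ (k (fst z) * k (snd z))"
        using B(2) by (auto simp: less_pairs_def f_def)
    qed (auto simp: A'0 f_def intro!: mult_nonneg_nonneg prod_nonneg)
    also have "(\<Prod>(r, s)\<in>less_pairs I. B r s * norm q ^ (k r * k s)) =
        B' * norm q ^ (\<Sum>(r, s)\<in>less_pairs I. k r * k s)"
      by (simp add: B'_def case_prod_unfold prod.distrib power_sum)
    also have "A' * (norm q ^ (\<Sum>r\<in>I. k r choose 2) *
          (B' * norm q ^ (\<Sum>(r, s)\<in>less_pairs I. k r * k s))) =
        (A' * B') * norm q ^ (sum k I choose 2)"
      by (simp add: choose_2_sum[OF fin] power_add)
    finally show ?thesis .
  qed
  then show ?thesis
    using that[of "A' * B'"] A'0 B'0 by auto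
qed

section \<open>Summation over multi-indices\<close>

text \<open>Every finite set of multi-indices lies in a box, over which the sum factors into finite
  geometric sums.\<close>

lemma summable_on_power_sum_PiE:
  fixes \<sigma> :: real
  assumes fin: "finite I" and \<sigma>: "0 \<le> \<sigma>" "\<sigma> < 1"
  shows "(\<lambda>k. \<sigma> ^ sum k I) summable_on (I \<rightarrow>\<^sub>E (UNIV :: nat set))"
proof (rule nonneg_bdd_above_summable_on)
  have "sum (\<lambda>k. \<sigma> ^ sum k I) F \<le> (1 / (1 - \<sigma>)) ^ card I"
    if F: "F \<subseteq> I \<rightarrow>\<^sub>E UNIV" "finite F" for F :: "('a \<Rightarrow> nat) set"
  proof -
    define N where "N = Max ((\<lambda>(k, r). k r) ` (F \<times> I))"
    have "k r \<le> N" if "k \<in> F" "r \<in> I" for k r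
      unfolding N_def using that fin F(2) by (intro Max_ge) (auto simp: image_iff)
    then have "F \<subseteq> I \<rightarrow>\<^sub>E {..N}"
      using F(1) by (auto simp: PiE_def Pi_def)
    then have "sum (\<lambda>k. \<sigma> ^ sum k I) F \<le> sum (\<lambda>k. \<sigma> ^ sum k I) (I \<rightarrow>\<^sub>E {..N})"
      using \<sigma> fin by (intro sum_mono2) (auto intro: finite_PiE)
    also have "\<dots> = (\<Prod>r\<in>I. \<Sum>j\<le>N. \<sigma> ^ j)"
      unfolding power_sum using fin by (subst prod_sum_PiE) auto
    also have "\<dots> \<le> (\<Prod>r\<in>I. 1 / (1 - \<sigma>))"
    proof (rule prod_mono)
      fix r assume "r \<in> I"
      have "(\<Sum>j\<le>N. \<sigma> ^ j) = (1 - \<sigma> ^ Suc N) / (1 - \<sigma>)"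
        using \<sigma> by (simp add: sum_gp0)
      also have "\<dots> \<le> 1 / (1 - \<sigma>)"
        using \<sigma> by (intro divide_right_mono) auto
      finally show "0 \<le> (\<Sum>j\<le>N. \<sigma> ^ j) \<and> (\<Sum>j\<le>N. \<sigma> ^ j) \<le> 1 / (1 - \<sigma>)"
        using \<sigma> by (auto intro: sum_nonneg)
    qed
    also have "\<dots> = (1 / (1 - \<sigma>)) ^ card I"
      by simp
    finally show ?thesis .
  qed
  then show "bdd_above (sum (\<lambda>k. \<sigma> ^ sum k I) ` {F. F \<subseteq> I \<rightarrow>\<^sub>E UNIV \<and> finite F})"
    by (intro bdd_aboveI[of _ "(1 / (1 - \<sigma>)) ^ card I"]) auto
qed (use \<sigma> in auto)

text \<open>Half of the decay, one factor sqrt \<rho>^K, is spent on absorbing the linear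
  factor.\<close>

lemma linear_times_power_bound:
  fixes \<rho> :: real
  assumes "0 \<le> \<rho>" "\<rho> < 1"
  obtains B where "B \<ge> 0" "\<And>K. (real K + 1) * \<rho> ^ K \<le> B * sqrt \<rho> ^ K"
proof -
  have s: "0 \<le> sqrt \<rho>" "sqrt \<rho> < 1"
    using assms by auto
  have "(\<lambda>K. real K * sqrt \<rho> ^ K + sqrt \<rho> ^ K) \<longlonglongrightarrow> 0 + 0"
    using s by (intro tendsto_add powser_times_n_limit_0 LIMSEQ_power_zero) auto
  then have "Bseq (\<lambda>K. real K * sqrt \<rho> ^ K + sqrt \<rho> ^ K)"
    by (intro convergent_imp_Bseq convergentI)
  then obtain B where B: "B > 0" "\<And>K. norm (real K * sqrt \<rho> ^ K + sqrt \<rho> ^ K) \<le> B"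
    by (auto elim: BseqE)
  have "(real K + 1) * \<rho> ^ K \<le> B * sqrt \<rho> ^ K" for K
  proof -
    have "(real K + 1) * \<rho> ^ K = (real K * sqrt \<rho> ^ K + sqrt \<rho> ^ K) * sqrt \<rho> ^ K"
      using assms by (simp add: algebra_simps flip: power_mult_distrib)
    also have "\<dots> \<le> B * sqrt \<rho> ^ K"
      using B(2)[of K] s by (intro mult_right_mono) auto
    finally show ?thesis .
  qed
  then show ?thesis
    using that[of B] B(1) by auto
qed

section \<open>The factor depending on |k| only, and the sum over all nonzero k\<close>

text \<open>The index K - 1 + e is right for K >= 1 only: for e = 1, truncated subtraction at K = 0
  yields (q)_1 where the identity has (q)_0. Level 0 is therefore treated apart.\<close>

definition radial_factor :: "complex \<Rightarrow> nat \<Rightarrow> nat \<Rightarrow> nat \<Rightarrow> complex" where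
  "radial_factor q e p K =
     (1 - q ^ (2 * K + e)) * qpoch q q (K - 1 + e) * inner_sum q e p K"

lemma radial_factor_diff:
  assumes "q \<noteq> 0" "norm q < 1"
  shows "radial_factor q e p (Suc n) * ((-1) ^ Suc n * q ^ (Suc n choose 2) / qpoch q q (Suc n)) =
         partial_sum q e p (Suc n) - partial_sum q e p n"
  using inner_sum_eq_diff[OF assms, of n e p] by (simp only: radial_factor_def diff_Suc_1)

text \<open>By \<open>radial_factor_diff\<close> the left side is the modulus of a consecutive
  difference of partial sums times (q)_K, so the cancellation inside \<open>inner_sum\<close> need
  not be exhibited.\<close>

lemma radial_factor_bound:
  assumes q0: "q \<noteq> 0" and q1: "norm q < 1"
  obtains B where "B \<ge> 0"
    "\<And>K. K \<ge> 1 \<Longrightarrow> norm (radial_factor q e p K) * norm q ^ (K choose 2) \<le> B * sqrt (norm q) ^ K"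
proof -
  let ?L = "1 / qpoch_inf q q ^ p" and ?S = "partial_sum q e p"
  obtain C where C: "C \<ge> 0" "\<And>N. norm (?S N - ?L) \<le> C * (real N + 1) * norm q ^ N"
    using partial_sum_rate[OF q1] by blast
  obtain A where A: "A > 0" "\<And>k. norm (qpoch q q k) \<le> A"
    using qpoch_bounded[OF q1, of q] by blast
  obtain D where D: "D \<ge> 0" "\<And>K. (real K + 1) * norm q ^ K \<le> D * sqrt (norm q) ^ K"
    using linear_times_power_bound[OF norm_ge_zero q1] by blast
  \<comment> \<open>C and C / |q| come from the errors at K and K - 1, D from absorbing K + 1, A
    from (q)_K.\<close>
  define B where "B = (C + C / norm q) * D * A"
  have B0: "B \<ge> 0"
    using C A D by (simp add: B_def)
  have "norm (radial_factor q e p K) * norm q ^ (K choose 2) \<le> B * sqrt (norm q) ^ K"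
    if K: "K \<ge> 1" for K
  proof -
    obtain n where n: "K = Suc n"
      using K by (cases K) auto
    have "norm (?S K - ?S n) = norm ((?S K - ?L) - (?S n - ?L))"
      by simp
    also have "\<dots> \<le> norm (?S K - ?L) + norm (?S n - ?L)"
      by (rule norm_triangle_ineq4)
    also have "\<dots> \<le> C * (real K + 1) * norm q ^ K + C * (real n + 1) * norm q ^ n"
      by (intro add_mono C)
    also have "C * (real n + 1) * norm q ^ n \<le> C / norm q * (real K + 1) * norm q ^ K"
      using q0 C(1) by (simp add: n field_simps mult_left_mono)
    finally have "norm (?S K - ?S n) \<le> (C + C / norm q) * ((real K + 1) * norm q ^ K)"
      by (simp add: algebra_simps add_divide_distrib)
    also have "\<dots> \<le> (C + C / norm q) * (D * sqrt (norm q) ^ K)"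
      using C(1) by (intro mult_left_mono D) auto
    finally have diff: "norm (?S K - ?S n) \<le> (C + C / norm q) * (D * sqrt (norm q) ^ K)" .
    have "norm (radial_factor q e p K) * norm q ^ (K choose 2) = norm (?S K - ?S n) * norm (qpoch q q K)"
      unfolding n radial_factor_diff[OF q0 q1, symmetric] norm_mult norm_divide norm_power
      using qpoch_q_nonzero[OF q1, of "Suc n"] by simp
    also have "\<dots> \<le> ((C + C / norm q) * (D * sqrt (norm q) ^ K)) * A"
      using C D A by (intro mult_mono diff A) auto
    finally show ?thesis
      by (simp add: B_def mult_ac)
  qed
  then show ?thesis
    using that B0 by blast
qed

text \<open>The Gaussian factor of the weight is exactly what the radial bound requires, leaving a
  multiple of sqrt |q|^|k|. Absolute summability comes first; the value is then found level by
  level.\<close>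

theorem outer_weight_radial_has_sum:
  fixes x :: "'i::linorder \<Rightarrow> complex"
  assumes fin: "finite I" and I0: "I \<noteq> {}" and gen: "q_generic q I x"
    and q0: "q \<noteq> 0" and q1: "norm q < 1"
  shows "((\<lambda>k. outer_weight q I x k * radial_factor q e p (sum k I)) has_sum
           1 / qpoch_inf q q ^ p - partial_sum q e p 0) {k \<in> I \<rightarrow>\<^sub>E UNIV. sum k I \<ge> 1}"
proof -
  let ?A = "{k \<in> I \<rightarrow>\<^sub>E UNIV. sum k I \<ge> 1}" and ?S = "partial_sum q e p"
  let ?H = "\<lambda>k. outer_weight q I x k * radial_factor q e p (sum k I)"
  obtain B1 where B1: "B1 \<ge> 0"
      "\<And>k. norm (outer_weight q I x k) \<le> B1 * norm q ^ (sum k I choose 2)"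
    using outer_weight_bound[OF fin gen q0 q1] by blast
  obtain B2 where B2: "B2 \<ge> 0"
      "\<And>K. K \<ge> 1 \<Longrightarrow> norm (radial_factor q e p K) * norm q ^ (K choose 2) \<le> B2 * sqrt (norm q) ^ K"
    using radial_factor_bound[OF q0 q1] by blast
  have H: "norm (?H k) \<le> B1 * B2 * sqrt (norm q) ^ sum k I" if "k \<in> ?A" for k
  proof -
    have "norm (?H k) \<le> (B1 * norm q ^ (sum k I choose 2)) * norm (radial_factor q e p (sum k I))"
      unfolding norm_mult by (intro mult_right_mono B1) auto
    also have "\<dots> = B1 * (norm (radial_factor q e p (sum k I)) * norm q ^ (sum k I choose 2))"
      by (simp only: mult_ac)
    also have "\<dots> \<le> B1 * (B2 * sqrt (norm q) ^ sum k I)"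
      using that B1(1) by (intro mult_left_mono B2) auto
    finally show ?thesis
      by (simp only: mult_ac)
  qed
  have "(\<lambda>k. B1 * B2 * sqrt (norm q) ^ sum k I) summable_on ?A"
    using q1
    by (intro summable_on_cmult_right summable_on_subset[OF summable_on_power_sum_PiE[OF fin]]) auto
  then have "(\<lambda>k. norm (?H k)) summable_on ?A"
    by (rule Infinite_Sum.abs_summable_on_comparison_test') (rule H)
  then have "?H summable_on ?A"
    by (rule abs_summable_summable)
  then obtain s where s: "(?H has_sum s) ?A"
    by (auto simp: summable_on_def)
  \<comment> \<open>Unconditional summability permits this regrouping; s stays abstract until the
    level sums have telescoped.\<close>
  then have "((\<lambda>(K, k). ?H k) has_sum s) (Sigma {1..} (index_level I))"
    by (subst has_sum_reindex_bij_witness[of _ "\<lambda>k. (sum k I, k)" snd ?A ?H])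
       (auto simp: index_level_def)
  then have "((\<lambda>K. \<Sum>k\<in>index_level I K. ?H k) has_sum s) {1..}"
    by (rule has_sum_SigmaD) (simp add: finite_index_level fin)
  then have "((\<lambda>n. \<Sum>k\<in>index_level I (Suc n). ?H k) has_sum s) UNIV"
    by (subst has_sum_reindex_bij_witness[of _ "\<lambda>K. K - 1" Suc "{1..}"
          "\<lambda>K. \<Sum>k\<in>index_level I K. ?H k"]) auto
  also have "(\<lambda>n. \<Sum>k\<in>index_level I (Suc n). ?H k) = (\<lambda>n. ?S (Suc n) - ?S n)"
  proof
    fix n
    have "(\<Sum>k\<in>index_level I (Suc n). ?H k) =
        radial_factor q e p (Suc n) * (\<Sum>k\<in>index_level I (Suc n). outer_weight q I x k)"
      unfolding sum_distrib_left by (intro sum.cong refl) (simp add: index_level_def)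
    then show "(\<Sum>k\<in>index_level I (Suc n). ?H k) = ?S (Suc n) - ?S n"
      unfolding outer_weight_sum[OF fin I0 gen q0 q1] radial_factor_diff[OF q0 q1] .
  qed
  finally have "(\<lambda>n. ?S (Suc n) - ?S n) sums s"
    by (rule has_sum_imp_sums)
  moreover have "?S \<longlonglongrightarrow> 1 / qpoch_inf q q ^ p"
  proof -
    obtain C where C: "C \<ge> 0"
        "\<And>N. norm (?S N - 1 / qpoch_inf q q ^ p) \<le> C * (real N + 1) * norm q ^ N"
      using partial_sum_rate[OF q1] by blast
    have "(\<lambda>N. real N * norm q ^ N) \<longlonglongrightarrow> 0" "(\<lambda>N. norm q ^ N) \<longlonglongrightarrow> 0"
      using q1 powser_times_n_limit_0[of "norm q"] LIMSEQ_power_zero[of "norm q"] by simp_all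
    then have "(\<lambda>N. C * (real N * norm q ^ N + norm q ^ N)) \<longlonglongrightarrow> C * (0 + 0)"
      by (rule tendsto_mult_left[OF tendsto_add])
    then have lim0: "(\<lambda>N. C * (real N * norm q ^ N + norm q ^ N)) \<longlonglongrightarrow> 0"
      by simp
    have "norm (?S N - 1 / qpoch_inf q q ^ p) \<le> C * (real N * norm q ^ N + norm q ^ N)" for N
      using C(2)[of N] by (simp add: distrib_left distrib_right mult.assoc)
    then have "(\<lambda>N. ?S N - 1 / qpoch_inf q q ^ p) \<longlonglongrightarrow> 0"
      by (intro Lim_null_comparison[OF always_eventually lim0] allI)
    then show ?thesis
      by (simp add: LIM_zero_iff)
  qed
  ultimately have "s = 1 / qpoch_inf q q ^ p - ?S 0"
    using telescope_sums sums_unique2 by blast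
  with s show ?thesis
    by simp
qed

section \<open>Translation of the stated summands into weight times radial factor\<close>

lemma prod_power_int_neg:
  fixes q :: complex
  shows "(\<Prod>s\<in>I. q powi (- int (k s))) = q powi (- int (sum k I))"
  by (simp add: power_int_minus power_sum prod_inversef[symmetric] del: of_nat_sum)

text \<open>The box m <= k may be enlarged to whole levels because the added terms vanish, and
  Milne's identity sums each level. All else depends on |m| only and is kept as an arbitrary
  \<open>g\<close>.\<close>

lemma inner_sum_collapse:
  fixes x :: "'i::linorder \<Rightarrow> complex"
  assumes fin: "finite I" and gen: "q_generic q I x" and q0: "q \<noteq> 0" and q1: "norm q < 1"
  shows "(\<Sum>m\<in>(\<Pi>\<^sub>E r\<in>I. {0..k r}). milne_weight q I x m *
            (\<Prod>r\<in>I. \<Prod>s\<in>I. qpoch q (q powi (- int (k s)) * (x r / x s)) (m r)) * g (sum m I)) =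
         (\<Sum>M\<le>sum k I. qpoch q (q powi (- int (sum k I))) M / qpoch q q M * g M)"
proof -
  let ?P = "\<Pi>\<^sub>E r\<in>I. {0..k r}"
  let ?f = "\<lambda>m. milne_weight q I x m *
            (\<Prod>r\<in>I. \<Prod>s\<in>I. qpoch q (q powi (- int (k s)) * (x r / x s)) (m r))"
  have "(\<Sum>m\<in>?P. ?f m * g (sum m I)) =
        (\<Sum>M\<le>sum k I. \<Sum>m\<in>{m \<in> ?P. sum m I = M}. ?f m * g (sum m I))"
    using fin by (intro sum.group[symmetric] finite_PiE) (auto simp: PiE_iff intro!: sum_mono)
  also have "\<dots> = (\<Sum>M\<le>sum k I. qpoch q (q powi (- int (sum k I))) M / qpoch q q M * g M)"
  proof (rule sum.cong[OF refl])
    fix M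
    have zero: "?f m = 0" if m: "m \<in> index_level I M" "m \<notin> ?P" for m
    proof -
      have "\<exists>r\<in>I. \<not> m r \<le> k r"
        using m by (auto simp: index_level_def PiE_def Pi_def)
      then obtain r where r: "r \<in> I" "k r < m r"
        by (auto simp: not_le)
      \<comment> \<open>The diagonal entry s = r has a zero factor at index k r, which is reached as
        soon as m r > k r.\<close>
      have "q powi (- int (k r)) * (x r / x r) * q ^ k r = 1"
        using q_genericD(1)[OF gen r(1)] q0 by (simp add: power_int_minus)
      then have "qpoch q (q powi (- int (k r)) * (x r / x r)) (m r) = 0"
        using qpoch_nonzero_iff r(2) by blast
      then have "(\<Prod>s\<in>I. qpoch q (q powi (- int (k s)) * (x r / x s)) (m r)) = 0"
        using r(1) by (intro prod_zero[OF fin] bexI[of _ r])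
      then have "\<exists>r\<in>I. (\<Prod>s\<in>I. qpoch q (q powi (- int (k s)) * (x r / x s)) (m r)) = 0"
        using r(1) by blast
      then have "(\<Prod>r\<in>I. \<Prod>s\<in>I. qpoch q (q powi (- int (k s)) * (x r / x s)) (m r)) = 0"
        by (rule prod_zero[OF fin])
      then show ?thesis
        by (simp only: mult_zero_right)
    qed
    have "(\<Sum>m\<in>{m \<in> ?P. sum m I = M}. ?f m * g (sum m I)) =
          (\<Sum>m\<in>{m \<in> ?P. sum m I = M}. ?f m * g M)"
      by (intro sum.cong) auto
    also have "\<dots> = (\<Sum>m\<in>index_level I M. ?f m * g M)"
    proof (intro sum.mono_neutral_left finite_index_level fin ballI)
      show "{m \<in> ?P. sum m I = M} \<subseteq> index_level I M"
        by (auto simp: index_level_def PiE_def)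
      fix m assume m: "m \<in> index_level I M - {m \<in> ?P. sum m I = M}"
      then have "m \<in> index_level I M" "m \<notin> ?P"
        unfolding index_level_def by blast+
      from zero[OF this] show "?f m * g M = 0"
        by (simp only: mult_zero_left)
    qed
    also have "\<dots> = (\<Sum>m\<in>index_level I M. ?f m) * g M"
      by (rule sum_distrib_right[symmetric])
    also have "(\<Sum>m\<in>index_level I M. ?f m) = qpoch q (q powi (- int (sum k I))) M / qpoch q q M"
      using milne_sum[OF fin gen q0 q1, where b = "\<lambda>_. 1" and a = "\<lambda>s. q powi (- int (k s))" and M = M]
      by (simp only: hom_qpoch_1 prod_power_int_neg prod.neutral_const)
    finally show "(\<Sum>m\<in>{m \<in> ?P. sum m I = M}. ?f m * g (sum m I)) =
        qpoch q (q powi (- int (sum k I))) M / qpoch q q M * g M" .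
  qed
  finally show ?thesis .
qed

text \<open>Multiplying the pair r < s by q^(m_s) clears the possibly negative exponent. Each s is
  the larger member of s - 1 pairs, which explains the power of q.\<close>

lemma vandermonde_ratio_eq:
  assumes q0: "q \<noteq> 0" and gen: "q_generic q {1..n} x"
  shows "vandermonde_ratio q n x m * q ^ (\<Sum>r=1..n. (r - 1) * m r) =
         shifted_vandermonde q {1..n} x m"
proof -
  have lp: "{(r, s). 1 \<le> r \<and> r < s \<and> s \<le> n} = less_pairs {1..n}"
    by (auto simp: less_pairs_def)
  have "(\<Sum>(r, s)\<in>less_pairs {1..n}. m s) = (\<Sum>s\<in>{1..n}. \<Sum>r\<in>{1..<s}. m s)"
    by (subst sum.Sigma) (auto simp: less_pairs_def intro!: sum.reindex_bij_witness[of _ prod.swap prod.swap])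
  then have "q ^ (\<Sum>r=1..n. (r - 1) * m r) = (\<Prod>(r, s)\<in>less_pairs {1..n}. q ^ m s)"
    by (simp add: power_sum[symmetric] case_prod_unfold)
  then show ?thesis
    unfolding vandermonde_ratio_def shifted_vandermonde_def lp
  proof (simp only: prod.distrib[symmetric] case_prod_unfold, intro prod.cong refl)
    fix z assume "z \<in> less_pairs {1..n}"
    then obtain r s where z: "z = (r, s)" "r \<in> {1..n}" "s \<in> {1..n}"
      by (auto simp: less_pairs_def)
    note xs = q_genericD(1)[OF gen z(3)]
    have a1: "(1 - q powi (int (m r) - int (m s)) * (x r / x s)) * q ^ m s =
          (x s * q ^ m s - x r * q ^ m r) / x s"
      using xs q0 by (simp add: power_int_diff field_simps)
    have a2: "1 - x r / x s = (x s - x r) / x s"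
      using xs by (simp add: field_simps)
    have "(1 - q powi (int (m r) - int (m s)) * (x r / x s)) / (1 - x r / x s) * q ^ m s =
          (x s * q ^ m s - x r * q ^ m r) / (x s - x r)"
      unfolding times_divide_eq_left a1 a2 using xs by simp
    also have "\<dots> = (x r * q ^ m r - x s * q ^ m s) / (x r - x s)"
      using minus_divide_divide[of "x r * q ^ m r - x s * q ^ m s" "x r - x s"]
      by (simp only: minus_diff_eq)
    finally show "(1 - q powi (int (m (fst z)) - int (m (snd z))) * (x (fst z) / x (snd z))) /
        (1 - x (fst z) / x (snd z)) * q ^ m (snd z) =
        (x (fst z) * q ^ m (fst z) - x (snd z) * q ^ m (snd z)) / (x (fst z) - x (snd z))"
      by (simp add: z(1))
  qed
qed

text \<open>\<open>c\<close> stands for the numerator depending on |k|; leaving it free lets one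
  lemma serve both identities.\<close>

lemma outer_weight_eq:
  assumes q0: "q \<noteq> 0" and gen: "q_generic q {1..n} x"
  shows "vandermonde_ratio q n x k
           * (c / (\<Prod>r=1..n. \<Prod>s=1..n. qpoch q (q * (x r / x s)) (k r)))
           * (-1) ^ (n * weight n k)
           * q ^ ((\<Sum>r=1..n. (r - 1) * k r) + n * (\<Sum>i=1..n. k i choose 2))
           * (\<Prod>r=1..n. x r powi (int n * int (k r) - int (weight n k)))
         = outer_weight q {1..n} x k * c"
proof -
  let ?I = "{1..n}" and ?K = "sum k {1..n}"
  have pow_pow: "(a ^ i) ^ n = a ^ (n * i)" for a :: complex and i
    by (simp add: power_mult[symmetric] mult.commute)
  have "(\<Prod>r\<in>?I. \<Prod>s\<in>?I. hom_qpoch q 0 (x r / x s) (k r)) =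
        (\<Prod>r\<in>?I. \<Prod>s\<in>?I. (-1) ^ k r * (x r ^ k r / x s ^ k r) * q ^ (k r choose 2))"
    by (simp add: hom_qpoch_0 power_minus[of "_ / _"] power_divide)
  also have "\<dots> = (\<Prod>r\<in>?I. (-1) ^ (n * k r) * (x r ^ (n * k r) / (\<Prod>s\<in>?I. x s ^ k r)) *
        q ^ (n * (k r choose 2)))"
    by (intro prod.cong refl)
       (simp add: prod.distrib prod_dividef power_mult_distrib power_divide pow_pow)
  also have "\<dots> = (-1) ^ (n * ?K) * ((\<Prod>r\<in>?I. x r ^ (n * k r)) / (\<Prod>r\<in>?I. \<Prod>s\<in>?I. x s ^ k r)) *
        q ^ (n * (\<Sum>i\<in>?I. k i choose 2))"
    by (simp add: prod.distrib prod_dividef sum_distrib_left power_sum)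
  also have "(\<Prod>r\<in>?I. \<Prod>s\<in>?I. x s ^ k r) = (\<Prod>s\<in>?I. x s ^ ?K)"
    by (subst prod.swap) (simp add: power_sum)
  also have "(\<Prod>r\<in>?I. x r ^ (n * k r)) / (\<Prod>s\<in>?I. x s ^ ?K) =
        (\<Prod>r\<in>?I. x r powi (int n * int (k r) - int ?K))"
    unfolding prod_dividef[symmetric]
  proof (rule prod.cong[OF refl])
    fix r assume "r \<in> ?I"
    then show "x r ^ (n * k r) / x r ^ ?K = x r powi (int n * int (k r) - int ?K)"
      using q_genericD(1)[OF gen] by (simp add: power_int_diff del: of_nat_sum flip: of_nat_mult)
  qed
  finally show ?thesis
    unfolding outer_weight_def milne_weight_def vandermonde_ratio_eq[OF q0 gen, symmetric]
      qpoch_matrix_def weight_def power_add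
    by simp
qed

lemma inner_sum_eq:
  assumes gen: "q_generic q {1..n} x" and q0: "q \<noteq> 0" and q1: "norm q < 1"
  shows "(\<Sum>m\<in>multi_indices_le n k.
                vandermonde_ratio q n x m
                * (\<Prod>r=1..n. \<Prod>s=1..n.
                     qpoch q (q powi (- int (k s)) * (x r / x s)) (m r)
                     / qpoch q (q * (x r / x s)) (m r))
                * (qpoch q (q ^ (weight n k + e)) (weight n m)
                   / qpoch q q (weight n m) ^ (p + 1))
                * q ^ (\<Sum>r=1..n. r * m r)) = inner_sum q e p (weight n k)"
proof -
  let ?I = "{1..n}"
  let ?g = "\<lambda>M. qpoch q (q ^ (weight n k + e)) M / qpoch q q M ^ (p + 1) * q ^ M"
  have "inner_sum q e p (weight n k) =
      (\<Sum>m\<in>(\<Pi>\<^sub>E r\<in>?I. {0..k r}). milne_weight q ?I x m *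
            (\<Prod>r\<in>?I. \<Prod>s\<in>?I. qpoch q (q powi (- int (k s)) * (x r / x s)) (m r)) * ?g (sum m ?I))"
    unfolding inner_sum_collapse[OF finite_atLeastAtMost gen q0 q1, where g = ?g]
    by (simp add: inner_sum_def weight_def mult.assoc)
  also have "\<dots> = (\<Sum>m\<in>multi_indices_le n k.
                vandermonde_ratio q n x m
                * (\<Prod>r=1..n. \<Prod>s=1..n.
                     qpoch q (q powi (- int (k s)) * (x r / x s)) (m r)
                     / qpoch q (q * (x r / x s)) (m r))
                * (qpoch q (q ^ (weight n k + e)) (weight n m)
                   / qpoch q q (weight n m) ^ (p + 1))
                * q ^ (\<Sum>r=1..n. r * m r))"
    unfolding multi_indices_le_def
  proof (rule sum.cong[OF refl])
    fix m
    \<comment> \<open>The part (r - 1) m_r is consumed by the Vandermonde ratio; the rest is the q^M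
      of \<open>inner_sum\<close>.\<close>
    have "(\<Sum>r\<in>?I. r * m r) = (\<Sum>r\<in>?I. (r - 1) * m r + m r)"
      by (intro sum.cong refl) (auto simp: algebra_simps)
    then have "q ^ (\<Sum>r\<in>?I. r * m r) = q ^ (\<Sum>r\<in>?I. (r - 1) * m r) * q ^ sum m ?I"
      by (simp add: sum.distrib power_add)
    then show "milne_weight q ?I x m *
            (\<Prod>r\<in>?I. \<Prod>s\<in>?I. qpoch q (q powi (- int (k s)) * (x r / x s)) (m r)) * ?g (sum m ?I) =
          vandermonde_ratio q n x m
                * (\<Prod>r=1..n. \<Prod>s=1..n.
                     qpoch q (q powi (- int (k s)) * (x r / x s)) (m r)
                     / qpoch q (q * (x r / x s)) (m r))
                * (qpoch q (q ^ (weight n k + e)) (weight n m)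
                   / qpoch q q (weight n m) ^ (p + 1))
                * q ^ (\<Sum>r=1..n. r * m r)"
      unfolding milne_weight_def qpoch_matrix_def prod_dividef weight_def
        vandermonde_ratio_eq[OF q0 gen, symmetric]
      by simp
  qed
  finally show ?thesis ..
qed

text \<open>A coincidence x_r q^i = x_s q^j with i = j contradicts distinctness; with i different
  from j it makes some denominator factorial vanish.\<close>

lemma q_generic_of_qpoch_nonzero:
  assumes q0: "q \<noteq> 0"
    and x0: "\<And>r. r \<in> {1..n} \<Longrightarrow> x r \<noteq> 0"
    and ne: "\<And>r s. 1 \<le> r \<Longrightarrow> r < s \<Longrightarrow> s \<le> n \<Longrightarrow> 1 - x r / x s \<noteq> 0"
    and nz: "\<And>r s j. r \<in> {1..n} \<Longrightarrow> s \<in> {1..n} \<Longrightarrow> qpoch q (q * (x r / x s)) j \<noteq> 0"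
  shows "q_generic q {1..n::nat} x"
proof -
  have lt: "x r * q ^ i \<noteq> x s * q ^ j" if rs: "r \<in> {1..n}" "s \<in> {1..n}" and "j < i" for r s i j
  proof
    assume eq: "x r * q ^ i = x s * q ^ j"
    \<comment> \<open>Factor number d of (q x_r/x_s)_j is 1 - (x_r/x_s) q^(d+1), hence the
      successor.\<close>
    define d where "d = i - Suc j"
    have "i = j + Suc d"
      using \<open>j < i\<close> by (simp add: d_def)
    with eq have "q * (x r / x s) * q ^ d = 1"
      using q0 x0[OF rs(2)] by (simp add: power_add field_simps)
    moreover have "q * (x r / x s) * q ^ d \<noteq> 1"
      using nz[OF rs, of "Suc d"] by (simp add: qpoch_nonzero_iff)
    ultimately show False
      by simp
  qed
  have ne': "x r \<noteq> x s" if "r \<in> {1..n}" "s \<in> {1..n}" "r \<noteq> s" for r s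
    using that x0 ne[of r s] ne[of s r] by (cases r s rule: linorder_cases) auto
  have "x r * q ^ i \<noteq> x s * q ^ j" if "r \<in> {1..n}" "s \<in> {1..n}" "r \<noteq> s" for r s i j
  proof (cases i j rule: linorder_cases)
    case less
    from lt[OF that(2,1) this] show ?thesis
      by (rule not_sym)
  next
    case equal
    with ne'[OF that] q0 show ?thesis
      by simp
  next
    case greater
    from lt[OF that(1,2) this] show ?thesis .
  qed
  then show ?thesis
    using x0 by (simp add: q_generic_def)
qed

theorem theorem5p2:
  fixes q :: complex and n p :: nat and x :: "nat \<Rightarrow> complex"
  assumes "0 < norm q" and "norm q < 1" and "n \<ge> 1"
    and "\<And>r. r \<in> {1..n} \<Longrightarrow> x r \<noteq> 0"
    and "\<And>r s. 1 \<le> r \<Longrightarrow> r < s \<Longrightarrow> s \<le> n \<Longrightarrow> 1 - x r / x s \<noteq> 0"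
    and "\<And>r s j. r \<in> {1..n} \<Longrightarrow> s \<in> {1..n} \<Longrightarrow> qpoch q (q * (x r / x s)) j \<noteq> 0"
  defines "F \<equiv> \<lambda>k :: nat \<Rightarrow> nat.
           vandermonde_ratio q n x k
           * ((1 - q ^ (2 * weight n k + 1)) * qpoch q q (weight n k)
              / (\<Prod>r=1..n. \<Prod>s=1..n. qpoch q (q * (x r / x s)) (k r)))
           * (-1) ^ (n * weight n k)
           * q ^ ((\<Sum>r=1..n. (r - 1) * k r) + n * (\<Sum>i=1..n. k i choose 2))
           * (\<Prod>r=1..n. x r powi (int n * int (k r) - int (weight n k)))
           * (\<Sum>m\<in>multi_indices_le n k.
                vandermonde_ratio q n x m
                * (\<Prod>r=1..n. \<Prod>s=1..n.
                     qpoch q (q powi (- int (k s)) * (x r / x s)) (m r)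
                     / qpoch q (q * (x r / x s)) (m r))
                * (qpoch q (q ^ (weight n k + 1)) (weight n m)
                   / qpoch q q (weight n m) ^ (p + 1))
                * q ^ (\<Sum>r=1..n. r * m r))"
    and "G \<equiv> \<lambda>k :: nat \<Rightarrow> nat.
           vandermonde_ratio q n x k
           * ((1 - q ^ (2 * weight n k)) * qpoch q q (weight n k - 1)
              / (\<Prod>r=1..n. \<Prod>s=1..n. qpoch q (q * (x r / x s)) (k r)))
           * (-1) ^ (n * weight n k)
           * q ^ ((\<Sum>r=1..n. (r - 1) * k r) + n * (\<Sum>i=1..n. k i choose 2))
           * (\<Prod>r=1..n. x r powi (int n * int (k r) - int (weight n k)))
           * (\<Sum>m\<in>multi_indices_le n k.
                vandermonde_ratio q n x m
                * (\<Prod>r=1..n. \<Prod>s=1..n.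
                     qpoch q (q powi (- int (k s)) * (x r / x s)) (m r)
                     / qpoch q (q * (x r / x s)) (m r))
                * (qpoch q (q ^ (weight n k)) (weight n m)
                   / qpoch q q (weight n m) ^ (p + 1))
                * q ^ (\<Sum>r=1..n. r * m r))"
  shows "(F summable_on multi_indices n
            \<and> 1 / qpoch_inf q q ^ p = (\<Sum>\<^sub>\<infinity>k\<in>multi_indices n. F k))
       \<and> (G summable_on {k \<in> multi_indices n. weight n k \<ge> 1}
            \<and> 1 / qpoch_inf q q ^ p = 1 + (\<Sum>\<^sub>\<infinity>k\<in>{k \<in> multi_indices n. weight n k \<ge> 1}. G k))"
proof -
  let ?L = "1 / qpoch_inf q q ^ p" and ?A = "{k \<in> multi_indices n. weight n k \<ge> 1}"
  have q0: "q \<noteq> 0"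
    using assms(1) by auto
  note q1 = \<open>norm q < 1\<close>
  have gen: "q_generic q {1..n} x"
    by (rule q_generic_of_qpoch_nonzero[OF q0 assms(4-6)])
  have I0: "{1..n} \<noteq> {}"
    using \<open>n \<ge> 1\<close> by simp
  have A: "?A = {k \<in> {1..n} \<rightarrow>\<^sub>E UNIV. sum k {1..n} \<ge> 1}"
    by (simp add: multi_indices_def weight_def)
  note main = outer_weight_radial_has_sum[OF finite_atLeastAtMost I0 gen q0 q1, folded A weight_def, of _ p]
  have F: "F k = outer_weight q {1..n} x k * ((1 - q ^ (2 * weight n k + 1)) *
             qpoch q q (weight n k) * inner_sum q 1 p (weight n k))" for k
    unfolding F_def inner_sum_eq[OF gen q0 q1] outer_weight_eq[OF q0 gen] by simp
  have G: "G k = outer_weight q {1..n} x k * ((1 - q ^ (2 * weight n k)) *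
             qpoch q q (weight n k - 1) * inner_sum q 0 p (weight n k))" for k
    unfolding G_def inner_sum_eq[OF gen q0 q1, where e = 0, unfolded add_0_right]
      outer_weight_eq[OF q0 gen] by simp
  have "(F has_sum ?L - partial_sum q 1 p 0) ?A"
    using main[of 1] by (rule has_sum_cong[THEN iffD1, rotated]) (auto simp: F radial_factor_def)
  \<comment> \<open>Level 0 is evaluated from \<open>F\<close> itself: its only term is 1 - q, the
    initial value subtracted by the telescoping.\<close>
  moreover have "(F has_sum partial_sum q 1 p 0) (index_level {1..n} 0)"
  proof -
    have "(\<Sum>k\<in>index_level {1..n} 0. F k) =
          (\<Sum>k\<in>index_level {1..n} 0. outer_weight q {1..n} x k) * partial_sum q 1 p 0"
      unfolding sum_distrib_right
      by (intro sum.cong refl)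
         (auto simp: F index_level_def weight_def inner_sum_def partial_sum_def euler_coeff_def
            qpoch_Suc numeral_2_eq_2)
    also have "\<dots> = partial_sum q 1 p 0"
      unfolding outer_weight_sum[OF finite_atLeastAtMost I0 gen q0 q1] by (simp add: numeral_2_eq_2)
    finally show ?thesis
      by (metis finite_atLeastAtMost finite_index_level has_sum_finite)
  qed
  ultimately have "(F has_sum (?L - partial_sum q 1 p 0) + partial_sum q 1 p 0)
      (?A \<union> index_level {1..n} 0)"
    by (rule has_sum_Un_disjoint) (auto simp: index_level_def weight_def)
  moreover have "?A \<union> index_level {1..n} 0 = multi_indices n"
    by (auto simp: index_level_def weight_def multi_indices_def Suc_le_eq simp del: sum_eq_0_iff)
  ultimately have "(F has_sum ?L) (multi_indices n)"
    by simp
  moreover have "(G has_sum ?L - 1) ?A"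
  proof -
    have "(G has_sum ?L - partial_sum q 0 p 0) ?A"
      using main[of 0] by (rule has_sum_cong[THEN iffD1, rotated]) (auto simp: G radial_factor_def)
    \<comment> \<open>For e = 0 the initial value is the explicit 1 of the second identity.\<close>
    moreover have "partial_sum q 0 p 0 = 1"
      by (simp add: partial_sum_def euler_coeff_def numeral_2_eq_2)
    ultimately show ?thesis
      by simp
  qed
  ultimately show ?thesis
    by (auto simp: has_sum_imp_summable infsumI)
qed

end
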